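(* Let $\mathcal{P}$ be a class of finitely generated groups such that (i) every metabelian group in $\mathcal{P}$ is virtually nilpotent; (ii) $\mathcal{P}$ is closed under the taking of finitely generated subgroups, quotients, central extensions, extensions by and of finite groups, and finite direct products. Then, for every group $G$, $\mathfrak{X}(G)\in\mathcal{P}$ if and only if $G\in\mathcal{P}$.
   Context: For a group $G$, let $\overline{G}$ be a second copy of $G$ with a fixed isomorphism $g\mapsto\overline{g}$. The group $\mathfrak{X}(G)$ is the quotient of the free product $G\ast\overline{G}$ by the normal closure of $\{[g,\overline{g}] : g\in G\}$. Classes of groups are closed under isomorphism. Closure under central extensions means: if $E$ is a finitely generated group with a central subgroup $Z$ such that $E/Z\in\mathcal{P}$, then $E\in\mathcal{P}$. Closure under extensions by and of finite groups means: if $1\to N\to E\to H\to 1$ is exact and either $N$ is finite and $H\in\mathcal{P}$, or $N\in\mathcal{P}$ and $H$ is finite, then $E\in\mathcal{P}$. *)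

theory Defs
  imports "HOL-Algebra.Algebra" "HOL-Library.Countable_Set"
begin

section \<open>Finitely generated, metabelian and virtually nilpotent groups\<close>

definition finitely_generated :: "('a, 'm) monoid_scheme \<Rightarrow> bool" where
  "finitely_generated G \<longleftrightarrow>
     (\<exists>S. finite S \<and> S \<subseteq> carrier G \<and> generate G S = carrier G)"

definition metabelian :: "('a, 'm) monoid_scheme \<Rightarrow> bool" where
  "metabelian G \<longleftrightarrow> derived G (derived G (carrier G)) = {\<one>\<^bsub>G\<^esub>}"

definition commutator :: "('a, 'm) monoid_scheme \<Rightarrow> 'a \<Rightarrow> 'a \<Rightarrow> 'a" where
  "commutator G x y = x \<otimes>\<^bsub>G\<^esub> y \<otimes>\<^bsub>G\<^esub> inv\<^bsub>G\<^esub> x \<otimes>\<^bsub>G\<^esub> inv\<^bsub>G\<^esub> y"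

primrec lower_central :: "('a, 'm) monoid_scheme \<Rightarrow> nat \<Rightarrow> 'a set" where
  "lower_central G 0 = carrier G"
| "lower_central G (Suc n) =
     generate G {commutator G x y | x y. x \<in> lower_central G n \<and> y \<in> carrier G}"

definition nilpotent_group :: "('a, 'm) monoid_scheme \<Rightarrow> bool" where
  "nilpotent_group G \<longleftrightarrow> (\<exists>n. lower_central G n = {\<one>\<^bsub>G\<^esub>})"

definition virtually_nilpotent :: "('a, 'm) monoid_scheme \<Rightarrow> bool" where
  "virtually_nilpotent G \<longleftrightarrow>
     (\<exists>H. subgroup H G \<and> finite (rcosets\<^bsub>G\<^esub> H) \<and> nilpotent_group (G\<lparr>carrier := H\<rparr>))"

section \<open>Free products\<close>

text \<open>
  The free product consists of the words over the disjoint union of the two carriers, modulo the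
  least congruence that multiplies adjacent letters of the same factor and erases the identities.
\<close>

inductive free_product_eq ::
  "('a, 'm) monoid_scheme \<Rightarrow> ('b, 'n) monoid_scheme \<Rightarrow> ('a + 'b) list \<Rightarrow> ('a + 'b) list \<Rightarrow> bool"
  for G H where
  refl: "w \<in> lists (Sum_Type.Plus (carrier G) (carrier H)) \<Longrightarrow> free_product_eq G H w w"
| sym: "free_product_eq G H u v \<Longrightarrow> free_product_eq G H v u"
| trans: "free_product_eq G H u v \<Longrightarrow> free_product_eq G H v w \<Longrightarrow> free_product_eq G H u w"
| append: "free_product_eq G H u u' \<Longrightarrow> free_product_eq G H v v' \<Longrightarrow>
     free_product_eq G H (u @ v) (u' @ v')"
| one_left: "free_product_eq G H [Inl \<one>\<^bsub>G\<^esub>] []"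
| one_right: "free_product_eq G H [Inr \<one>\<^bsub>H\<^esub>] []"
| mult_left: "x \<in> carrier G \<Longrightarrow> y \<in> carrier G \<Longrightarrow>
     free_product_eq G H [Inl x, Inl y] [Inl (x \<otimes>\<^bsub>G\<^esub> y)]"
| mult_right: "x \<in> carrier H \<Longrightarrow> y \<in> carrier H \<Longrightarrow>
     free_product_eq G H [Inr x, Inr y] [Inr (x \<otimes>\<^bsub>H\<^esub> y)]"

definition word_class ::
  "('a, 'm) monoid_scheme \<Rightarrow> ('b, 'n) monoid_scheme \<Rightarrow> ('a + 'b) list \<Rightarrow> ('a + 'b) list set" where
  "word_class G H u = {v. free_product_eq G H u v}"

definition free_product ::
  "('a, 'm) monoid_scheme \<Rightarrow> ('b, 'n) monoid_scheme \<Rightarrow> ('a + 'b) list set monoid" where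
  "free_product G H =
     \<lparr>carrier = word_class G H ` lists (Sum_Type.Plus (carrier G) (carrier H)),
      monoid.mult = (\<lambda>A B. \<Union>u\<in>A. \<Union>v\<in>B. word_class G H (u @ v)),
      one = word_class G H []\<rparr>"

lemma free_product_eq_words:
  assumes "group G" "group H" "free_product_eq G H u v"
  shows "u \<in> lists (Sum_Type.Plus (carrier G) (carrier H)) \<and>
    v \<in> lists (Sum_Type.Plus (carrier G) (carrier H))"
proof -
  interpret G: group G by fact
  interpret H: group H by fact
  from assms(3) show ?thesis
    by induction auto
qed

lemma word_class_eq_iff:
  assumes "u \<in> lists (Sum_Type.Plus (carrier G) (carrier H))"
  shows "word_class G H u = word_class G H v \<longleftrightarrow> free_product_eq G H u v"
  using assms unfolding word_class_def
  by (blast intro: free_product_eq.refl free_product_eq.sym free_product_eq.trans)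

lemma free_product_mult:
  assumes "u \<in> lists (Sum_Type.Plus (carrier G) (carrier H))"
    "v \<in> lists (Sum_Type.Plus (carrier G) (carrier H))"
  shows "word_class G H u \<otimes>\<^bsub>free_product G H\<^esub> word_class G H v = word_class G H (u @ v)"
proof -
  have "u \<in> word_class G H u" "v \<in> word_class G H v"
    using assms by (auto simp: word_class_def intro: free_product_eq.refl)
  then show ?thesis
    unfolding free_product_def word_class_def
    by simp (blast intro: free_product_eq.append free_product_eq.sym free_product_eq.trans)
qed

lemma free_product_group:
  assumes "group G" "group H"
  shows "group (free_product G H)"
proof -
  interpret G: group G by fact
  interpret H: group H by fact
  let ?W = "lists (Sum_Type.Plus (carrier G) (carrier H))"
  have car: "carrier (free_product G H) = word_class G H ` ?W"
    and one: "\<one>\<^bsub>free_product G H\<^esub> = word_class G H []"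
    by (simp_all add: free_product_def)
  have inv: "\<exists>v\<in>?W. free_product_eq G H (v @ u) []" if "u \<in> ?W" for u
    using that
  proof (induction u)
    case Nil
    show ?case by (rule bexI[of _ "[]"]) (auto intro: free_product_eq.refl)
  next
    case (Cons a u)
    then obtain v where v: "v \<in> ?W" "free_product_eq G H (v @ u) []" by auto
    have "\<exists>b \<in> Sum_Type.Plus (carrier G) (carrier H). free_product_eq G H [b, a] []"
    proof (cases a)
      case (Inl x)
      with Cons have x: "x \<in> carrier G" by auto
      have "free_product_eq G H [Inl (inv\<^bsub>G\<^esub> x), Inl x] [Inl \<one>\<^bsub>G\<^esub>]"
        using free_product_eq.mult_left[of "inv\<^bsub>G\<^esub> x" G x H] x by simp
      then show ?thesis
        using Inl x by (intro bexI[of _ "Inl (inv\<^bsub>G\<^esub> x)"])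
          (auto intro: free_product_eq.trans free_product_eq.one_left)
    next
      case (Inr x)
      with Cons have x: "x \<in> carrier H" by auto
      have "free_product_eq G H [Inr (inv\<^bsub>H\<^esub> x), Inr x] [Inr \<one>\<^bsub>H\<^esub>]"
        using free_product_eq.mult_right[of "inv\<^bsub>H\<^esub> x" H x G] x by simp
      then show ?thesis
        using Inr x by (intro bexI[of _ "Inr (inv\<^bsub>H\<^esub> x)"])
          (auto intro: free_product_eq.trans free_product_eq.one_right)
    qed
    then obtain b where b: "b \<in> Sum_Type.Plus (carrier G) (carrier H)" "free_product_eq G H [b, a] []"
      by blast
    have u: "u \<in> ?W" using Cons by simp
    have "free_product_eq G H (v @ ([b, a] @ u)) (v @ ([] @ u))"
      by (intro free_product_eq.append free_product_eq.refl v u b)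
    then show ?case
      using v b by (intro bexI[of _ "v @ [b]"])
        (auto intro: free_product_eq.trans)
  qed
  show ?thesis
  proof (rule groupI)
    fix A assume "A \<in> carrier (free_product G H)"
    then obtain u where u: "u \<in> ?W" "A = word_class G H u" by (auto simp: car)
    with inv obtain v where v: "v \<in> ?W" "free_product_eq G H (v @ u) []" by blast
    have "word_class G H (v @ u) = word_class G H []"
      using u v word_class_eq_iff[of "v @ u" G H "[]"] by simp
    then show "\<exists>B\<in>carrier (free_product G H). B \<otimes>\<^bsub>free_product G H\<^esub> A = \<one>\<^bsub>free_product G H\<^esub>"
      using u v by (intro bexI[of _ "word_class G H v"]) (auto simp: car one free_product_mult)
  next
    fix A B assume "A \<in> carrier (free_product G H)" "B \<in> carrier (free_product G H)"
    then obtain u v where uv: "u \<in> ?W" "v \<in> ?W" "A = word_class G H u" "B = word_class G H v"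
      by (auto simp only: car)
    then have "u @ v \<in> ?W" by simp
    with uv show "A \<otimes>\<^bsub>free_product G H\<^esub> B \<in> carrier (free_product G H)"
      unfolding car by (simp only: free_product_mult) (rule imageI)
  next
    fix A B C
    assume "A \<in> carrier (free_product G H)" "B \<in> carrier (free_product G H)"
      "C \<in> carrier (free_product G H)"
    then obtain u v w where uvw: "u \<in> ?W" "v \<in> ?W" "w \<in> ?W"
      "A = word_class G H u" "B = word_class G H v" "C = word_class G H w"
      by (auto simp only: car)
    then have "u @ v \<in> ?W" "v @ w \<in> ?W" by simp_all
    with uvw show "A \<otimes>\<^bsub>free_product G H\<^esub> B \<otimes>\<^bsub>free_product G H\<^esub> C =
      A \<otimes>\<^bsub>free_product G H\<^esub> (B \<otimes>\<^bsub>free_product G H\<^esub> C)"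
      by (simp only: free_product_mult append_assoc)
  next
    fix A assume "A \<in> carrier (free_product G H)"
    then obtain u where u: "u \<in> ?W" "A = word_class G H u" by (auto simp only: car)
    have "[] \<in> ?W" by simp
    with u show "\<one>\<^bsub>free_product G H\<^esub> \<otimes>\<^bsub>free_product G H\<^esub> A = A"
      unfolding one by (simp only: free_product_mult append_Nil)
  qed (simp add: car one)
qed

section \<open>The weak commutativity construction\<close>

definition normal_closure :: "('a, 'm) monoid_scheme \<Rightarrow> 'a set \<Rightarrow> 'a set" where
  "normal_closure G S = \<Inter>{N. N \<lhd> G \<and> S \<subseteq> N}"

text \<open>
  The second copy of \<open>G\<close> is the second factor of \<open>free_product G G\<close>: the word \<open>[Inl g]\<close>
  stands for \<open>g\<close>, and \<open>[Inr g]\<close> for the corresponding element of the copy.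
\<close>

definition weak_commutativity_group ::
  "('a, 'm) monoid_scheme \<Rightarrow> ('a + 'a) list set set monoid" (\<open>\<XX>\<close>) where
  "\<XX> G = free_product G G Mod
     normal_closure (free_product G G)
       {commutator (free_product G G) (word_class G G [Inl g]) (word_class G G [Inr g]) | g.
          g \<in> carrier G}"

lemma normal_normal_closure:
  assumes "group G" "S \<subseteq> carrier G"
  shows "normal_closure G S \<lhd> G"
proof -
  interpret group G by fact
  let ?F = "{N. N \<lhd> G \<and> S \<subseteq> N}"
  have "carrier G \<lhd> G"
    by (intro normal_invI subgroup_self) auto
  with assms(2) have "?F \<noteq> {}" by blast
  then have "subgroup (\<Inter>?F) G"
    by (intro subgroups_Inter) (auto simp: normal_def)
  then show ?thesis
    unfolding normal_closure_def
    by (rule normal_invI) (auto intro: normal.inv_op_closed2)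
qed

lemma weak_commutativity_group_group:
  assumes "group G"
  shows "group (\<XX> G)"
proof -
  interpret F: group "free_product G G" by (rule free_product_group) (rule assms)+
  have "word_class G G [Inl g] \<in> carrier (free_product G G)"
    "word_class G G [Inr g] \<in> carrier (free_product G G)" if "g \<in> carrier G" for g
    using that by (auto simp: free_product_def intro!: imageI)
  then show ?thesis
    unfolding weak_commutativity_group_def
    by (intro normal.factorgroup_is_group normal_normal_closure F.is_group)
      (auto simp: commutator_def)
qed

section \<open>Classes of finitely generated groups\<close>

text \<open>
  A finitely generated group is countable, so it is isomorphic to a group whose elements are
  natural numbers (lemma \<open>finitely_generated_nat_copy\<close> below).
  A class of finitely generated groups that is closed under isomorphism is therefore given by its
  members of type \<^typ>\<open>nat monoid\<close>; a group over any other type belongs to the class if it is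
  isomorphic to one of these members.
\<close>

definition fg_group_class :: "nat monoid set \<Rightarrow> bool" where
  "fg_group_class P \<longleftrightarrow>
     (\<forall>G\<in>P. group G \<and> finitely_generated G) \<and>
     (\<forall>G\<in>P. \<forall>H. group H \<and> G \<cong> H \<longrightarrow> H \<in> P)"

definition in_class :: "('a, 'm) monoid_scheme \<Rightarrow> nat monoid set \<Rightarrow> bool" where
  "in_class G P \<longleftrightarrow> (\<exists>H\<in>P. G \<cong> H)"

definition closed_under_fg_subgroups :: "nat monoid set \<Rightarrow> bool" where
  "closed_under_fg_subgroups P \<longleftrightarrow>
     (\<forall>G\<in>P. \<forall>H. subgroup H G \<and> finitely_generated (G\<lparr>carrier := H\<rparr>) \<longrightarrow> G\<lparr>carrier := H\<rparr> \<in> P)"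

definition closed_under_quotients :: "nat monoid set \<Rightarrow> bool" where
  "closed_under_quotients P \<longleftrightarrow> (\<forall>G\<in>P. \<forall>N. N \<lhd> G \<longrightarrow> in_class (G Mod N) P)"

definition central_subgroup :: "'a set \<Rightarrow> ('a, 'm) monoid_scheme \<Rightarrow> bool" where
  "central_subgroup Z G \<longleftrightarrow>
     subgroup Z G \<and> (\<forall>z\<in>Z. \<forall>x\<in>carrier G. z \<otimes>\<^bsub>G\<^esub> x = x \<otimes>\<^bsub>G\<^esub> z)"

definition closed_under_central_extensions :: "nat monoid set \<Rightarrow> bool" where
  "closed_under_central_extensions P \<longleftrightarrow>
     (\<forall>E Z. group E \<and> finitely_generated E \<and> central_subgroup Z E \<and> in_class (E Mod Z) P
        \<longrightarrow> E \<in> P)"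

text \<open>
  \<^const>\<open>short_exact_sequence\<close> lists the groups and the maps from right to left: below, \<open>i\<close> embeds
  \<open>N\<close> into \<open>E\<close>, and \<open>q\<close> maps \<open>E\<close> onto \<open>H\<close>. All three groups are countable, because two of them
  are finite or finitely generated.
\<close>

definition closed_under_finite_extensions :: "nat monoid set \<Rightarrow> bool" where
  "closed_under_finite_extensions P \<longleftrightarrow>
     (\<forall>N E H i q. short_exact_sequence H E N q i \<and>
        (finite (carrier N) \<and> H \<in> P \<or> N \<in> P \<and> finite (carrier H)) \<longrightarrow> E \<in> P)"

text \<open>
  The empty product is left out, as it would exclude the empty class; a nonempty class that is
  closed under quotients contains the trivial group anyway.
\<close>

definition closed_under_finite_products :: "nat monoid set \<Rightarrow> bool" where
  "closed_under_finite_products P \<longleftrightarrow>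
     (\<forall>(I :: nat set) G. finite I \<and> I \<noteq> {} \<and> (\<forall>i\<in>I. G i \<in> P) \<longrightarrow> in_class (product_group I G) P)"

lemma finitely_generated_nat_copy:
  fixes G (structure)
  assumes "group G" "finitely_generated G"
  shows "\<exists>H :: nat monoid. group H \<and> G \<cong> H"
proof -
  interpret group G by fact
  obtain S where S: "finite S" "S \<subseteq> carrier G" "generate G S = carrier G"
    using assms(2) by (auto simp: finitely_generated_def)
  let ?T = "S \<union> m_inv G ` S"
  have "x \<in> (\<lambda>w. foldr (\<otimes>) w \<one>) ` lists ?T" if "x \<in> generate G S" for x
    using that
  proof induction
    case one
    show ?case by (rule image_eqI[of _ _ "[]"]) auto
  next
    case (incl h)
    then show ?case using S by (intro image_eqI[of _ _ "[h]"]) auto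
  next
    case (inv h)
    then show ?case using S by (intro image_eqI[of _ _ "[inv h]"]) auto
  next
    case (eng h1 h2)
    then obtain u v where uv: "u \<in> lists ?T" "v \<in> lists ?T"
      "h1 = foldr (\<otimes>) u \<one>" "h2 = foldr (\<otimes>) v \<one>" by auto
    have T: "?T \<subseteq> carrier G" using S by auto
    have cl: "foldr (\<otimes>) w \<one> \<in> carrier G" if "w \<in> lists ?T" for w
      using that by (induction w) (use T in auto)
    have "foldr (\<otimes>) (u @ v) \<one> = foldr (\<otimes>) u \<one> \<otimes> foldr (\<otimes>) v \<one>"
      using uv(1)
    proof (induction u)
      case (Cons a u)
      then have "a \<in> carrier G" "foldr (\<otimes>) u \<one> \<in> carrier G" using T cl by auto
      then show ?case using Cons cl[OF uv(2)] by (simp add: m_assoc)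
    qed (use cl uv in auto)
    with uv show ?case by (intro image_eqI[of _ _ "u @ v"]) auto
  qed
  moreover have "countable (lists ?T)"
    using S by (intro countable_lists countable_finite) auto
  ultimately have "countable (carrier G)"
    unfolding S(3)[symmetric] by (meson countable_image countable_subset subsetI)
  then obtain f :: "'a \<Rightarrow> nat" where f: "inj_on f (carrier G)"
    by (auto simp: countable_def)
  define g where "g = inv_into (carrier G) f"
  define H where "H = \<lparr>carrier = f ` carrier G, monoid.mult = (\<lambda>x y. f (g x \<otimes> g y)), one = f \<one>\<rparr>"
  have gf: "g (f x) = x" if "x \<in> carrier G" for x
    using f that by (simp add: g_def)
  have "group H"
  proof (rule groupI)
    fix x assume "x \<in> carrier H"
    then obtain a where a: "a \<in> carrier G" "x = f a" by (auto simp: H_def)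
    then show "\<exists>y\<in>carrier H. y \<otimes>\<^bsub>H\<^esub> x = \<one>\<^bsub>H\<^esub>"
      by (intro bexI[of _ "f (inv a)"]) (auto simp: H_def gf)
  qed (auto simp: H_def gf m_assoc)
  moreover have "f \<in> iso G H"
    using f by (auto simp: iso_def hom_def H_def gf bij_betw_def)
  ultimately show ?thesis by (auto simp: is_iso_def)
qed

end

theory Submission
  imports Defs
begin

text \<open>
  Write \<open>E = \<XX> G\<close>, with copies \<open>a\<close>, \<open>b\<close> of \<open>G\<close> and projections \<open>p\<^sub>1\<close>, \<open>p\<^sub>2\<close>, \<open>p\<^sub>3\<close>, where \<open>p\<^sub>1\<close>
  kills \<open>b\<close>, \<open>p\<^sub>2\<close> kills \<open>a\<close>, and \<open>p\<^sub>3\<close> folds the two copies together. As \<open>G\<close> is a quotient of \<open>E\<close>,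
  only \<open>E \<in> P\<close> for \<open>G \<in> P\<close> needs a proof. Sidki showed that \<open>D = ker p\<^sub>1 \<inter> ker p\<^sub>2\<close> and \<open>L = ker p\<^sub>3\<close>
  commute, so \<open>W = D \<inter> L\<close> is abelian and \<open>E\<close> acts on it through the abelianization of \<open>G\<close>, while
  \<open>E / W\<close> embeds into \<open>G\<^sup>3\<close> and so lies in \<open>P\<close>. The point is that a normal subgroup \<open>Y\<close> of finite
  index acts nilpotently on \<open>W\<close>: then \<open>Y\<close> is reached from \<open>Y / W\<close> by finitely many central
  extensions, and \<open>E\<close> is a finite extension of \<open>Y\<close>.

  By (i), \<open>G / G''\<close> is virtually nilpotent, so some normal subgroup \<open>K\<close> of finite index in \<open>G\<close> acts
  nilpotently on \<open>G / G''\<close>; take \<open>Y = p\<^sub>3\<^sup>-\<^sup>1(K)\<close>. Filter \<open>W\<close> by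
  \<open>L' \<supseteq> [L\<^sub>3, L] \<supseteq> [L\<^sub>3, L\<^sub>3] \<supseteq> [L\<^sub>2, L\<^sub>1]\<close>, where \<open>L\<^sub>1\<close>, \<open>L\<^sub>2\<close> are the parts of \<open>L\<close> killed by \<open>p\<^sub>2\<close> and \<open>p\<^sub>1\<close>
  and \<open>L\<^sub>3 = L\<^sub>1 L\<^sub>2\<close>. On \<open>L / L'\<close> the action is by commuting unipotents with \<open>(g - 1)\<^sup>2 = 0\<close>, and
  \<open>G\<close> is finitely generated. Each other step follows from the three subgroups lemma: the action on
  \<open>[L\<^sub>3, L] / [L\<^sub>3, L\<^sub>3]\<close> and on \<open>[L\<^sub>2, L\<^sub>1]\<close> is controlled by that of \<open>K\<close> on \<open>G' / G''\<close>, and the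
  remaining factors are acted on unipotently by all of \<open>E\<close>.
\<close>

section \<open>Commutator calculus\<close>

text \<open>Iterating \<open>centralizer_mod G B\<close> from \<open>N\<close> gives an upper
  central series relative to \<open>B\<close>. Nilpotency of the action of \<open>B\<close> on
  \<open>A\<close> modulo \<open>N\<close> is expressed throughout as
  \<open>A \<subseteq> (centralizer_mod G B ^^ n) N\<close>.\<close>

definition centralizer_mod :: "('a, 'm) monoid_scheme \<Rightarrow> 'a set \<Rightarrow> 'a set \<Rightarrow> 'a set" where
  "centralizer_mod G B N = {x \<in> carrier G. \<forall>b\<in>B. commutator G x b \<in> N}"

definition commutator_subgroup :: "('a, 'm) monoid_scheme \<Rightarrow> 'a set \<Rightarrow> 'a set \<Rightarrow> 'a set" where
  "commutator_subgroup G A B = generate G {commutator G a b | a b. a \<in> A \<and> b \<in> B}"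

lemma centralizer_modI:
  "x \<in> carrier G \<Longrightarrow> (\<And>y. y \<in> B \<Longrightarrow> commutator G x y \<in> N) \<Longrightarrow> x \<in> centralizer_mod G B N"
  by (simp add: centralizer_mod_def)

lemma centralizer_modD: "x \<in> centralizer_mod G B N \<Longrightarrow> y \<in> B \<Longrightarrow> commutator G x y \<in> N"
  by (simp add: centralizer_mod_def)

section \<open>Commutator identities and centralizers modulo a normal subgroup\<close>

context group
begin

lemma mult_inv_cancel_left [simp]:
  assumes "x \<in> carrier G" "y \<in> carrier G"
  shows "x \<otimes> (inv x \<otimes> y) = y" "inv x \<otimes> (x \<otimes> y) = y"
  using assms by (simp_all flip: m_assoc)

text \<open>Together with the cancellation rules above, these bring every word in elements of the
  carrier to its reduced form, so identities valid in all groups follow by simplification.\<close>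

lemmas word_simps = commutator_def m_assoc inv_mult_group

lemma commutator_closed [simp, intro]:
  "x \<in> carrier G \<Longrightarrow> y \<in> carrier G \<Longrightarrow> commutator G x y \<in> carrier G"
  by (simp add: commutator_def)

lemma commutator_mult_left:
  assumes "x \<in> carrier G" "y \<in> carrier G" "z \<in> carrier G"
  shows "commutator G (x \<otimes> y) z = x \<otimes> commutator G y z \<otimes> inv x \<otimes> commutator G x z"
  using assms by (simp add: word_simps)

lemma commutator_inv_left:
  assumes "x \<in> carrier G" "z \<in> carrier G"
  shows "commutator G (inv x) z = inv x \<otimes> inv (commutator G x z) \<otimes> x"
  using assms by (simp add: word_simps)

lemma inv_commutator:
  assumes "x \<in> carrier G" "y \<in> carrier G"
  shows "inv (commutator G x y) = commutator G y x"
  using assms by (simp add: word_simps)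

lemma conj_commutator:
  assumes "x \<in> carrier G" "y \<in> carrier G" "z \<in> carrier G"
  shows "z \<otimes> commutator G x y \<otimes> inv z = commutator G (z \<otimes> x \<otimes> inv z) (z \<otimes> y \<otimes> inv z)"
  using assms by (simp add: word_simps)

text \<open>The Hall-Witt identity. The conjugations sit on the outer right entries, where a normal
  subgroup absorbs them.\<close>

lemma hall_witt:
  assumes "a \<in> carrier G" "b \<in> carrier G" "c \<in> carrier G"
  shows "commutator G (commutator G a b) (b \<otimes> c \<otimes> inv b) \<otimes>
    (commutator G (commutator G b c) (c \<otimes> a \<otimes> inv c) \<otimes>
     commutator G (commutator G c a) (a \<otimes> b \<otimes> inv a)) = \<one>"
  using assms by (simp add: word_simps)

lemma conj_mem_normal: "N \<lhd> G \<Longrightarrow> x \<in> carrier G \<Longrightarrow> n \<in> N \<Longrightarrow> x \<otimes> n \<otimes> inv x \<in> N"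
  by (rule normal.inv_op_closed2)

lemma conj'_mem_normal: "N \<lhd> G \<Longrightarrow> x \<in> carrier G \<Longrightarrow> n \<in> N \<Longrightarrow> inv x \<otimes> n \<otimes> x \<in> N"
  by (rule normal.inv_op_closed1)

lemma normal_subset: "N \<lhd> G \<Longrightarrow> n \<in> N \<Longrightarrow> n \<in> carrier G"
  by (rule subgroup.mem_carrier[OF normal_imp_subgroup])

lemma normal_carrier: "carrier G \<lhd> G"
  by (intro normal_invI subgroup_self) auto

lemma commutator_mem_normal_left:
  assumes "N \<lhd> G" "x \<in> N" "y \<in> carrier G"
  shows "commutator G x y \<in> N"
proof -
  have "x \<in> carrier G" using assms normal_subset by blast
  then have "commutator G x y = x \<otimes> (y \<otimes> inv x \<otimes> inv y)"
    using assms by (simp add: word_simps)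
  then show ?thesis
    using assms by (metis conj_mem_normal normal_imp_subgroup subgroup.m_closed subgroup.m_inv_closed)
qed

lemma commutator_mem_swap:
  assumes "subgroup N G" "x \<in> carrier G" "y \<in> carrier G" "commutator G x y \<in> N"
  shows "commutator G y x \<in> N"
  using assms by (metis inv_commutator subgroup.m_inv_closed)

lemma commutator_mem_normal_right:
  assumes "N \<lhd> G" "x \<in> carrier G" "y \<in> N"
  shows "commutator G x y \<in> N"
  by (rule commutator_mem_swap[OF normal_imp_subgroup[OF assms(1)]])
    (use assms commutator_mem_normal_left[OF assms(1,3,2)] normal_subset[OF assms(1,3)] in auto)

text \<open>Expanding a commutator in its left entry costs only conjugations, which \<open>N\<close>
  absorbs. With \<open>B\<close> an arbitrary subset, even a single element, this lets a commutator
  condition checked on generators extend to the subgroup that they generate.\<close>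

lemma centralizer_mod_subgroup:
  assumes "B \<subseteq> carrier G" "N \<lhd> G"
  shows "subgroup (centralizer_mod G B N) G"
proof -
  interpret N: normal N G by fact
  show ?thesis
  proof (rule subgroupI)
    have "commutator G \<one> b = \<one>" if "b \<in> B" for b
      using that assms(1) by (auto simp: word_simps)
    then have "\<one> \<in> centralizer_mod G B N" by (auto simp: centralizer_mod_def)
    then show "centralizer_mod G B N \<noteq> {}" by blast
  next
    fix x assume x: "x \<in> centralizer_mod G B N"
    then show "inv x \<in> centralizer_mod G B N"
      using assms(1) unfolding centralizer_mod_def
      by (auto simp: commutator_inv_left subset_iff intro!: N.inv_op_closed1)
  next
    fix x y assume "x \<in> centralizer_mod G B N" "y \<in> centralizer_mod G B N"
    then show "x \<otimes> y \<in> centralizer_mod G B N"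
      using assms(1) unfolding centralizer_mod_def
      by (auto simp: commutator_mult_left subset_iff intro!: N.m_closed N.inv_op_closed2)
  qed (auto simp: centralizer_mod_def)
qed

lemma centralizer_mod_normal:
  assumes "B \<lhd> G" "N \<lhd> G"
  shows "centralizer_mod G B N \<lhd> G"
proof (rule normal_invI)
  show "subgroup (centralizer_mod G B N) G"
    by (rule centralizer_mod_subgroup) (use normal_subset[OF assms(1)] assms(2) in auto)
next
  fix x z assume xz: "z \<in> carrier G" "x \<in> centralizer_mod G B N"
  have "commutator G (z \<otimes> x \<otimes> inv z) b \<in> N" if b: "b \<in> B" for b
  proof -
    have bc: "b \<in> carrier G" using assms b normal_subset by blast
    have "inv z \<otimes> b \<otimes> z \<in> B" by (rule conj'_mem_normal) (use assms b xz in auto)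
    then have "z \<otimes> commutator G x (inv z \<otimes> b \<otimes> z) \<otimes> inv z \<in> N"
      using xz by (intro conj_mem_normal assms) (auto simp: centralizer_mod_def)
    also have "z \<otimes> commutator G x (inv z \<otimes> b \<otimes> z) \<otimes> inv z = commutator G (z \<otimes> x \<otimes> inv z) b"
      using xz bc by (auto simp: word_simps centralizer_mod_def)
    finally show ?thesis .
  qed
  then show "z \<otimes> x \<otimes> inv z \<in> centralizer_mod G B N"
    using xz by (auto simp: centralizer_mod_def)
qed

lemma subset_centralizer_mod:
  assumes "N \<lhd> G" "B \<subseteq> carrier G"
  shows "N \<subseteq> centralizer_mod G B N"
  using assms(2) commutator_mem_normal_left[OF assms(1)] normal_subset[OF assms(1)]
  by (auto simp: centralizer_mod_def)

lemma centralizer_mod_mono: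
  "N \<subseteq> N' \<Longrightarrow> B' \<subseteq> B \<Longrightarrow> centralizer_mod G B N \<subseteq> centralizer_mod G B' N'"
  by (auto simp: centralizer_mod_def)

lemma funpow_centralizer_mod_normal:
  assumes "B \<lhd> G" "N \<lhd> G"
  shows "(centralizer_mod G B ^^ i) N \<lhd> G"
  by (induction i) (auto intro: assms centralizer_mod_normal)

lemma subset_funpow_centralizer_mod:
  assumes "B \<lhd> G" "N \<lhd> G"
  shows "N \<subseteq> (centralizer_mod G B ^^ i) N"
proof (induction i)
  case (Suc i)
  have "(centralizer_mod G B ^^ i) N \<subseteq> centralizer_mod G B ((centralizer_mod G B ^^ i) N)"
    using normal_subset[OF assms(1)] assms
    by (intro subset_centralizer_mod funpow_centralizer_mod_normal) auto
  with Suc show ?case by auto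
qed simp

lemma funpow_centralizer_mod_mono:
  assumes "N \<subseteq> N'" "B' \<subseteq> B"
  shows "(centralizer_mod G B ^^ i) N \<subseteq> (centralizer_mod G B' ^^ i) N'"
  by (induction i) (simp_all add: assms centralizer_mod_mono)

section \<open>Commutator subgroups and the three subgroups lemma\<close>

lemma commutator_subgroup_normal:
  assumes "A \<lhd> G" "B \<lhd> G"
  shows "commutator_subgroup G A B \<lhd> G"
  unfolding commutator_subgroup_def
proof (rule normal_generateI)
  show "{commutator G a b |a b. a \<in> A \<and> b \<in> B} \<subseteq> carrier G"
    using normal_subset[OF assms(1)] normal_subset[OF assms(2)] by auto
next
  fix h g assume "h \<in> {commutator G a b |a b. a \<in> A \<and> b \<in> B}" "g \<in> carrier G"
  then obtain a b where ab: "h = commutator G a b" "a \<in> A" "b \<in> B" "g \<in> carrier G" by auto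
  then have "g \<otimes> h \<otimes> inv g = commutator G (g \<otimes> a \<otimes> inv g) (g \<otimes> b \<otimes> inv g)"
    using conj_commutator normal_subset[OF assms(1)] normal_subset[OF assms(2)] by auto
  then show "g \<otimes> h \<otimes> inv g \<in> {commutator G a b |a b. a \<in> A \<and> b \<in> B}"
    using conj_mem_normal[OF assms(1)] conj_mem_normal[OF assms(2)] ab by blast
qed

lemma commutator_in_commutator_subgroup:
  "a \<in> A \<Longrightarrow> b \<in> B \<Longrightarrow> commutator G a b \<in> commutator_subgroup G A B"
  unfolding commutator_subgroup_def by (blast intro: generate.incl)

lemma commutator_subgroup_least:
  assumes "subgroup N G" "\<And>a b. a \<in> A \<Longrightarrow> b \<in> B \<Longrightarrow> commutator G a b \<in> N"
  shows "commutator_subgroup G A B \<subseteq> N"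
  unfolding commutator_subgroup_def by (rule generate_subgroup_incl) (use assms in auto)

text \<open>In the Hall-Witt identity two of the three factors lie in \<open>N\<close>, hence so
  does the third. The hypotheses concern single commutators, which is how they are verified in each
  application.\<close>

lemma three_subgroups:
  assumes "C \<lhd> G" "A \<lhd> G" "B \<lhd> G" "N \<lhd> G"
    and bca: "\<And>a b c. a \<in> A \<Longrightarrow> b \<in> B \<Longrightarrow> c \<in> C \<Longrightarrow> commutator G (commutator G b c) a \<in> N"
    and cab: "\<And>a b c. a \<in> A \<Longrightarrow> b \<in> B \<Longrightarrow> c \<in> C \<Longrightarrow> commutator G (commutator G c a) b \<in> N"
  shows "commutator_subgroup G A B \<subseteq> centralizer_mod G C N"
proof (rule commutator_subgroup_least)
  show "subgroup (centralizer_mod G C N) G"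
    by (rule normal_imp_subgroup[OF centralizer_mod_normal[OF assms(1,4)]])
next
  fix a b assume ab: "a \<in> A" "b \<in> B"
  interpret N: normal N G by fact
  have car: "a \<in> carrier G" "b \<in> carrier G"
    using normal_subset[OF assms(2) ab(1)] normal_subset[OF assms(3) ab(2)] .
  have "commutator G (commutator G a b) c' \<in> N" if "c' \<in> C" for c'
  proof -
    \<comment> \<open>Normality of \<open>C\<close> brings an arbitrary \<open>c'\<close> into the
      conjugated shape that occurs in the Hall-Witt identity.\<close>
    define c where "c = inv b \<otimes> c' \<otimes> b"
    have cC: "c \<in> C" unfolding c_def using that car by (intro conj'_mem_normal assms)
    have cc: "c \<in> carrier G" "c' \<in> carrier G"
      using normal_subset[OF assms(1) cC] normal_subset[OF assms(1) that] .
    have c': "c' = b \<otimes> c \<otimes> inv b" using cc car by (simp add: c_def m_assoc)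
    let ?u = "commutator G (commutator G b c) (c \<otimes> a \<otimes> inv c)"
    let ?v = "commutator G (commutator G c a) (a \<otimes> b \<otimes> inv a)"
    have u: "?u \<in> N" 
      by (rule bca) (use ab cC cc car conj_mem_normal[OF assms(2)] in auto)
    have v: "?v \<in> N" 
      by (rule cab) (use ab cC cc car conj_mem_normal[OF assms(3)] in auto)
    have "commutator G (commutator G a b) c' = inv (?u \<otimes> ?v)"
      unfolding c' by (intro inv_equality[symmetric] hall_witt) (use cc car in auto)
    with u v show ?thesis by simp
  qed
  then show "commutator G a b \<in> centralizer_mod G C N"
    using car by (auto simp: centralizer_mod_def)
qed

text \<open>Commutators pair \<open>S\<close> with \<open>T\<close> modulo \<open>N\<close>. The
  hypotheses say that the pairing ignores \<open>V\<close> on the left and the effect of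
  \<open>Y\<close> on the right, so nilpotency of \<open>Y\<close> on \<open>S\<close> modulo
  \<open>V\<close> carries over to the commutators modulo \<open>N\<close>. Each stage is one use of
  the three subgroups lemma.\<close>

lemma commutator_in_funpow_centralizer_mod:
  assumes "S \<lhd> G" "T \<lhd> G" "Y \<lhd> G" "V \<lhd> G" "N \<lhd> G"
    and TYS: "\<And>t y s. t \<in> T \<Longrightarrow> y \<in> Y \<Longrightarrow> s \<in> S \<Longrightarrow> commutator G (commutator G t y) s \<in> N"
    and SVT: "\<And>s t. s \<in> S \<Longrightarrow> s \<in> V \<Longrightarrow> t \<in> T \<Longrightarrow> commutator G s t \<in> N"
  shows "commutator_subgroup G (S \<inter> (centralizer_mod G Y ^^ i) V) T \<subseteq>
    (centralizer_mod G Y ^^ i) N"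
proof (induction i)
  case 0
  show ?case
    by (simp, rule commutator_subgroup_least) (use SVT normal_imp_subgroup[OF assms(5)] in auto)
next
  case (Suc i)
  let ?Z = "\<lambda>i. centralizer_mod G Y ^^ i"
  have nV: "?Z j V \<lhd> G" and nN: "?Z j N \<lhd> G" for j
    using funpow_centralizer_mod_normal assms(3-5) by simp_all
  have N: "N \<subseteq> ?Z i N" by (rule subset_funpow_centralizer_mod[OF assms(3,5)])
  have "commutator_subgroup G (S \<inter> ?Z (Suc i) V) T \<subseteq> centralizer_mod G Y (?Z i N)"
  proof (rule three_subgroups)
    fix a t y assume a: "a \<in> S \<inter> ?Z (Suc i) V" and t: "t \<in> T" and y: "y \<in> Y"
    show "commutator G (commutator G t y) a \<in> ?Z i N"
      using TYS[OF t y] a N by blast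
    have car: "a \<in> carrier G" "y \<in> carrier G"
      using a normal_subset[OF assms(1)] normal_subset[OF assms(3) y] by auto
    have "commutator G y a \<in> ?Z i V"
      by (rule commutator_mem_swap[OF normal_imp_subgroup[OF nV]])
        (use a y car in \<open>auto simp: centralizer_mod_def\<close>)
    moreover have "commutator G y a \<in> S"
      using commutator_mem_normal_right[OF assms(1)] car a by blast
    ultimately show "commutator G (commutator G y a) t \<in> ?Z i N"
      using Suc t by (meson IntI commutator_in_commutator_subgroup subsetD)
  qed (use assms(1-3) nV[of "Suc i"] nN normal_subgroup_intersect in simp_all)
  then show ?case by simp
qed

text \<open>Commutators of elements of the normal subgroup \<open>W\<close> stay in
  \<open>W\<close>, so after \<open>i\<close> stages one lands in \<open>W \<inter> B\<close>, from
  where \<open>j\<close> more stages lead to \<open>N\<close>. This glues the links of the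
  filtration of \<open>W\<close>.\<close>

lemma funpow_centralizer_mod_compose:
  assumes "W \<lhd> G" "Y \<subseteq> carrier G"
    and A: "W \<inter> A \<subseteq> (centralizer_mod G Y ^^ i) B" and B: "W \<inter> B \<subseteq> (centralizer_mod G Y ^^ j) N"
  shows "W \<inter> A \<subseteq> (centralizer_mod G Y ^^ (i + j)) N"
proof -
  have "W \<inter> (centralizer_mod G Y ^^ i) B \<subseteq> (centralizer_mod G Y ^^ i) (W \<inter> B)"
  proof (induction i)
    case (Suc i)
    have "centralizer_mod G Y U \<inter> W \<subseteq> centralizer_mod G Y (W \<inter> U)" for U
      using assms(2) commutator_mem_normal_left[OF assms(1)] by (auto simp: centralizer_mod_def)
    with centralizer_mod_mono[OF Suc order_refl, of Y] show ?case by fastforce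
  qed simp
  also have "\<dots> \<subseteq> (centralizer_mod G Y ^^ i) ((centralizer_mod G Y ^^ j) N)"
    by (rule funpow_centralizer_mod_mono) (use B in auto)
  finally show ?thesis using A by (auto simp: funpow_add)
qed

end

section \<open>The structure of the weak commutativity group\<close>

context group
begin

lemma commutator_mult_right:
  assumes "x \<in> carrier G" "y \<in> carrier G" "z \<in> carrier G"
  shows "commutator G x (y \<otimes> z) = commutator G x y \<otimes> (y \<otimes> commutator G x z \<otimes> inv y)"
  using assms by (simp add: word_simps)

lemma conj_commutator_left:
  assumes "x \<in> carrier G" "y \<in> carrier G" "z \<in> carrier G"
  shows "z \<otimes> commutator G x y \<otimes> inv z = commutator G (z \<otimes> x) y \<otimes> inv (commutator G z y)"
  using assms by (simp add: word_simps)

lemma conj_inv: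
  assumes "x \<in> carrier G" "y \<in> carrier G"
  shows "x \<otimes> inv y \<otimes> inv x = inv (x \<otimes> y \<otimes> inv x)"
  using assms by (simp add: word_simps)

lemma conj_mult:
  assumes "x \<in> carrier G" "y \<in> carrier G" "z \<in> carrier G"
  shows "x \<otimes> (y \<otimes> z) \<otimes> inv x = (x \<otimes> y \<otimes> inv x) \<otimes> (x \<otimes> z \<otimes> inv x)"
  using assms by (simp add: word_simps)

lemma conj_mem_generate:
  assumes "S \<subseteq> carrier G" "x \<in> carrier G"
    and conj: "\<And>y. y \<in> S \<Longrightarrow> x \<otimes> y \<otimes> inv x \<in> generate G S"
    and y: "y \<in> generate G S"
  shows "x \<otimes> y \<otimes> inv x \<in> generate G S"
  using y
proof (induction y)
  case one
  then show ?case using assms(2) by (simp add: generate.one)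
next
  case (inv y)
  then show ?case
    using assms(1,2) generate_m_inv_closed[OF assms(1) conj[OF inv]] by (simp add: conj_inv subset_iff)
next
  case (eng y z)
  then have "y \<in> carrier G" "z \<in> carrier G" using generate_in_carrier[OF assms(1)] by auto
  with eng assms(2) show ?case by (simp add: conj_mult generate.eng)
qed (rule conj)

text \<open>Collects the product of two normal forms, factors from the first copy before those from
  the second, at the price of conjugates and one commutator. It serves the description of
  \<open>D\<close> by generators.\<close>

lemma mult_products:
  assumes "m \<in> carrier G" "n \<in> carrier G" "a \<in> carrier G" "b \<in> carrier G" "a' \<in> carrier G"
    "b' \<in> carrier G"
  shows "(m \<otimes> (a \<otimes> b)) \<otimes> (n \<otimes> (a' \<otimes> b')) =
    (m \<otimes> (a \<otimes> (b \<otimes> n \<otimes> inv b) \<otimes> inv a) \<otimes> (a \<otimes> commutator G b a' \<otimes> inv a)) \<otimes>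
      ((a \<otimes> a') \<otimes> (b \<otimes> b'))"
  using assms by (simp add: word_simps)

lemma inv_comm:
  assumes "x \<in> carrier G" "y \<in> carrier G" "x \<otimes> y = y \<otimes> x"
  shows "inv y \<otimes> x = x \<otimes> inv y"
  using assms by (metis inv_closed inv_solve_left' inv_solve_right m_assoc m_closed)

lemma commutator_eq_one_iff:
  assumes "x \<in> carrier G" "y \<in> carrier G"
  shows "commutator G x y = \<one> \<longleftrightarrow> x \<otimes> y = y \<otimes> x"
proof -
  have "commutator G x y = (x \<otimes> y) \<otimes> inv (y \<otimes> x)"
    using assms by (simp add: word_simps)
  then show ?thesis
    using assms by (simp add: inv_solve_right')
qed

text \<open>Abstracts the computation behind \<open>[g, h'] = [g', h]\<close>, where a prime marks
  the second copy: \<open>a\<close> and \<open>c\<close> play the two copies of one element,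
  \<open>b\<close> and \<open>d\<close> those of another, and the third relation is the one for
  their product.\<close>

lemma commutator_eq_of_products_commute:
  assumes car: "a \<in> carrier G" "b \<in> carrier G" "c \<in> carrier G" "d \<in> carrier G"
    and ac: "a \<otimes> c = c \<otimes> a" and bd: "b \<otimes> d = d \<otimes> b"
    and abcd: "(a \<otimes> b) \<otimes> (c \<otimes> d) = (c \<otimes> d) \<otimes> (a \<otimes> b)"
  shows "commutator G (inv a) d = commutator G (inv c) b"
proof -
  have "a \<otimes> commutator G (inv c) b \<otimes> (b \<otimes> d) = (a \<otimes> inv c) \<otimes> (b \<otimes> (c \<otimes> d))"
    using car by (simp add: word_simps)
  also have "\<dots> = inv c \<otimes> ((a \<otimes> b) \<otimes> (c \<otimes> d))"
    using car inv_comm[OF _ _ ac] by (simp flip: m_assoc)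
  also have "\<dots> = d \<otimes> a \<otimes> b"
    unfolding abcd using car by (simp add: m_assoc)
  also have "\<dots> = a \<otimes> commutator G (inv a) d \<otimes> (d \<otimes> b)"
    using car by (simp add: word_simps)
  also have "\<dots> = a \<otimes> commutator G (inv a) d \<otimes> (b \<otimes> d)"
    by (simp add: bd)
  finally show ?thesis
    using car by simp
qed

end

text \<open>All that the argument uses of the presentation: two generating copies of
  \<open>G\<close> that commute elementwise, and the three projections that the universal property
  provides.\<close>

locale weak_commutativity = E: group E + G: group G
  for E :: "('x, 'm) monoid_scheme" (structure) and G :: "('g, 'n) monoid_scheme" +
  fixes a b :: "'g \<Rightarrow> 'x" and p\<^sub>1 p\<^sub>2 p\<^sub>3 :: "'x \<Rightarrow> 'g"
  assumes a_hom: "a \<in> hom G E" and b_hom: "b \<in> hom G E"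
    and p\<^sub>1_hom: "p\<^sub>1 \<in> hom E G" and p\<^sub>2_hom: "p\<^sub>2 \<in> hom E G" and p\<^sub>3_hom: "p\<^sub>3 \<in> hom E G"
    and carrier_generated: "generate E (a ` carrier G \<union> b ` carrier G) = carrier E"
    and a_b_commute: "g \<in> carrier G \<Longrightarrow> a g \<otimes> b g = b g \<otimes> a g"
    and p\<^sub>1_a [simp]: "g \<in> carrier G \<Longrightarrow> p\<^sub>1 (a g) = g"
    and p\<^sub>1_b [simp]: "g \<in> carrier G \<Longrightarrow> p\<^sub>1 (b g) = \<one>\<^bsub>G\<^esub>"
    and p\<^sub>2_a [simp]: "g \<in> carrier G \<Longrightarrow> p\<^sub>2 (a g) = \<one>\<^bsub>G\<^esub>"
    and p\<^sub>2_b [simp]: "g \<in> carrier G \<Longrightarrow> p\<^sub>2 (b g) = g"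
    and p\<^sub>3_a [simp]: "g \<in> carrier G \<Longrightarrow> p\<^sub>3 (a g) = g"
    and p\<^sub>3_b [simp]: "g \<in> carrier G \<Longrightarrow> p\<^sub>3 (b g) = g"

sublocale weak_commutativity \<subseteq> a: group_hom G E a by unfold_locales (rule a_hom)
sublocale weak_commutativity \<subseteq> b: group_hom G E b by unfold_locales (rule b_hom)
sublocale weak_commutativity \<subseteq> p\<^sub>1: group_hom E G p\<^sub>1 by unfold_locales (rule p\<^sub>1_hom)
sublocale weak_commutativity \<subseteq> p\<^sub>2: group_hom E G p\<^sub>2 by unfold_locales (rule p\<^sub>2_hom)
sublocale weak_commutativity \<subseteq> p\<^sub>3: group_hom E G p\<^sub>3 by unfold_locales (rule p\<^sub>3_hom)

lemma (in group_hom) hom_commutator: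
  assumes "x \<in> carrier G" "y \<in> carrier G"
  shows "h (commutator G x y) = commutator H (h x) (h y)"
  using assms by (simp add: commutator_def)

lemma (in group_hom) normal_vimage:
  assumes "N \<lhd> H"
  shows "{x \<in> carrier G. h x \<in> N} \<lhd> G"
proof -
  interpret N: normal N H by fact
  show ?thesis
    by (intro G.normal_invI G.subgroupI) (auto simp: N.inv_op_closed2)
qed

section \<open>Generators of the kernels \<open>L\<close> and \<open>D\<close>, and their
  commutation\<close>

context weak_commutativity
begin

definition L where "L = kernel E G p\<^sub>3"
definition K\<^sub>1 where "K\<^sub>1 = kernel E G p\<^sub>1"
definition K\<^sub>2 where "K\<^sub>2 = kernel E G p\<^sub>2"
definition D where "D = K\<^sub>1 \<inter> K\<^sub>2"
definition W where "W = L \<inter> D"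

lemmas mem_kernels = L_def K\<^sub>1_def K\<^sub>2_def kernel_def

lemma L_normal: "L \<lhd> E" and K\<^sub>1_normal: "K\<^sub>1 \<lhd> E" and K\<^sub>2_normal: "K\<^sub>2 \<lhd> E"
  by (simp_all add: L_def K\<^sub>1_def K\<^sub>2_def p\<^sub>1.normal_kernel p\<^sub>2.normal_kernel p\<^sub>3.normal_kernel)

lemma D_normal: "D \<lhd> E"
  unfolding D_def by (rule E.normal_subgroup_intersect[OF K\<^sub>1_normal K\<^sub>2_normal])

lemma W_normal: "W \<lhd> E"
  unfolding W_def by (rule E.normal_subgroup_intersect[OF L_normal D_normal])

text \<open>Both copies of \<open>G\<close> are closed under inverses, so together they generate
  \<open>E\<close> already under multiplication.\<close>

lemma carrier_induct [consumes 1, case_names a b mult]: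
  assumes "x \<in> carrier E"
    and a: "\<And>g. g \<in> carrier G \<Longrightarrow> P (a g)" and b: "\<And>g. g \<in> carrier G \<Longrightarrow> P (b g)"
    and mult: "\<And>x y. x \<in> carrier E \<Longrightarrow> y \<in> carrier E \<Longrightarrow> P x \<Longrightarrow> P y \<Longrightarrow> P (x \<otimes> y)"
  shows "P x"
proof -
  have "x \<in> generate E (a ` carrier G \<union> b ` carrier G)"
    using assms(1) carrier_generated by simp
  then have "x \<in> carrier E \<and> P x"
  proof induction
    case one
    then show ?case using a[of "\<one>\<^bsub>G\<^esub>"] by simp
  next
    case (incl h)
    then show ?case using a b by auto
  next
    case (inv h)
    then obtain g where g: "g \<in> carrier G" "h = a g \<or> h = b g" by auto
    then have "P (inv h)" using a[of "inv\<^bsub>G\<^esub> g"] b[of "inv\<^bsub>G\<^esub> g"] by auto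
    with g show ?case by auto
  qed (auto intro: mult)
  then show ?thesis by simp
qed

text \<open>Three instances of the defining relation, for the inverse of \<open>g\<close>, for
  \<open>h\<close> and for their product, combine into this symmetry.\<close>

lemma commutator_a_b_swap:
  assumes "g \<in> carrier G" "h \<in> carrier G"
  shows "commutator E (a g) (b h) = commutator E (b g) (a h)"
proof -
  define k where "k = inv\<^bsub>G\<^esub> g"
  have k: "k \<in> carrier G" "inv\<^bsub>G\<^esub> k = g" using assms by (auto simp: k_def)
  have "commutator E (inv (a k)) (b h) = commutator E (inv (b k)) (a h)"
    using k assms a_b_commute[of k] a_b_commute[of h] a_b_commute[of "k \<otimes>\<^bsub>G\<^esub> h"]
    by (intro E.commutator_eq_of_products_commute) auto
  with k show ?thesis by (simp flip: a.hom_inv b.hom_inv)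
qed

text \<open>The commutators of \<open>g\<close> with the product of \<open>h\<close> and
  \<open>k\<close> agree for either distribution over the two copies. Expanding both and cancelling
  the common first factor leaves the two conjugates.\<close>

lemma a_conj_eq_b_conj:
  assumes "g \<in> carrier G" "h \<in> carrier G" "k \<in> carrier G"
  shows "a h \<otimes> commutator E (a g) (b k) \<otimes> inv (a h) = b h \<otimes> commutator E (a g) (b k) \<otimes> inv (b h)"
proof -
  have "commutator E (a g) (b h) \<otimes> (b h \<otimes> commutator E (a g) (b k) \<otimes> inv (b h)) =
      commutator E (a g) (b (h \<otimes>\<^bsub>G\<^esub> k))"
    using assms by (simp add: E.commutator_mult_right)
  also have "\<dots> = commutator E (b g) (a (h \<otimes>\<^bsub>G\<^esub> k))"
    using assms by (intro commutator_a_b_swap) auto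
  also have "\<dots> = commutator E (b g) (a h) \<otimes> (a h \<otimes> commutator E (b g) (a k) \<otimes> inv (a h))"
    using assms by (simp add: E.commutator_mult_right)
  also have "\<dots> = commutator E (a g) (b h) \<otimes> (a h \<otimes> commutator E (a g) (b k) \<otimes> inv (a h))"
    using assms by (simp add: commutator_a_b_swap)
  finally show ?thesis using assms by simp
qed

definition l where "l g = b g \<otimes> inv (a g)"

lemma l_closed [simp]: "g \<in> carrier G \<Longrightarrow> l g \<in> carrier E"
  by (simp add: l_def)

lemma b_eq: "g \<in> carrier G \<Longrightarrow> b g = l g \<otimes> a g"
  by (simp add: l_def E.m_assoc)

lemma l_in_L: "g \<in> carrier G \<Longrightarrow> l g \<in> L"
  by (simp add: mem_kernels l_def)

lemma l_commutes_a:
  assumes "g \<in> carrier G"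
  shows "l g \<otimes> a g = a g \<otimes> l g"
proof -
  have "a g \<otimes> l g = (a g \<otimes> b g) \<otimes> inv (a g)"
    using assms by (simp add: l_def E.m_assoc)
  also have "\<dots> = b g"
    unfolding a_b_commute[OF assms] using assms by (simp add: E.m_assoc)
  finally show ?thesis
    using assms b_eq by simp
qed

lemma conj_l:
  assumes "g \<in> carrier G" "h \<in> carrier G"
  shows "a g \<otimes> l h \<otimes> inv (a g) = inv (l g) \<otimes> l (g \<otimes>\<^bsub>G\<^esub> h)"
  using assms by (simp add: l_def E.word_simps)

text \<open>By the derivation rule, the subgroup generated by the elements \<open>l g\<close> is
  normalized by the first copy, so each \<open>x\<close> is a product of one of its elements with
  \<open>a (p\<^sub>3 x)\<close>. On \<open>L\<close> the second factor is trivial.\<close>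

lemma L_generated: "L = generate E (l ` carrier G)"
proof
  let ?M = "generate E (l ` carrier G)"
  have sg: "subgroup ?M E" by (rule E.generate_is_subgroup) auto
  interpret M: subgroup ?M E by (rule sg)
  have l: "l g \<in> ?M" if "g \<in> carrier G" for g
    using that by (auto intro: generate.incl)
  show "?M \<subseteq> L"
    by (rule E.generate_subgroup_incl) (use l_in_L normal_imp_subgroup[OF L_normal] in auto)
  have conj: "a g \<otimes> m \<otimes> inv (a g) \<in> ?M" if g: "g \<in> carrier G" and m: "m \<in> ?M" for g m
    by (rule E.conj_mem_generate) (use g l m in \<open>auto simp: conj_l\<close>)
  have normal_form: "\<exists>m\<in>?M. x = m \<otimes> a (p\<^sub>3 x)" if "x \<in> carrier E" for x
    using that
  proof (induction rule: carrier_induct)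
    case (a g)
    then show ?case by (intro bexI[of _ \<one>]) auto
  next
    case (b g)
    then show ?case using l by (intro bexI[of _ "l g"]) (simp_all, rule b_eq)
  next
    case (mult x y)
    then obtain m n where mn: "m \<in> ?M" "x = m \<otimes> a (p\<^sub>3 x)" "n \<in> ?M" "y = n \<otimes> a (p\<^sub>3 y)"
      by blast
    have "x \<otimes> y = (m \<otimes> a (p\<^sub>3 x)) \<otimes> (n \<otimes> a (p\<^sub>3 y))"
      by (rule arg_cong2[OF mn(2,4)])
    also have "\<dots> = m \<otimes> (a (p\<^sub>3 x) \<otimes> n \<otimes> inv (a (p\<^sub>3 x))) \<otimes> a (p\<^sub>3 (x \<otimes> y))"
      using mn(1,3) mult by (simp add: E.m_assoc)
    finally show ?case
      using mn(1) conj[OF p\<^sub>3.hom_closed[OF mult(1)] mn(3)] by (rule bexI[OF _ M.m_closed])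
  qed
  show "L \<subseteq> ?M"
  proof
    fix x assume x: "x \<in> L"
    then have x: "x \<in> carrier E" "p\<^sub>3 x = \<one>\<^bsub>G\<^esub>" by (simp_all add: mem_kernels)
    then obtain m where "m \<in> ?M" "x = m \<otimes> a (p\<^sub>3 x)"
      using normal_form by blast
    then show "x \<in> ?M" unfolding x(2) by simp
  qed
qed

text \<open>The commutators generate a subgroup normalized by both copies, so each \<open>x\<close>
  has a normal form with last factors \<open>a (p\<^sub>1 x)\<close> and
  \<open>b (p\<^sub>2 x)\<close>. On \<open>D\<close> both of these vanish.\<close>

lemma D_generated:
  "D = generate E {commutator E (a g) (b h) | g h. g \<in> carrier G \<and> h \<in> carrier G}"
proof
  let ?C = "{commutator E (a g) (b h) | g h. g \<in> carrier G \<and> h \<in> carrier G}"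
  let ?M = "generate E ?C"
  have sg: "subgroup ?M E" by (rule E.generate_is_subgroup) auto
  interpret M: subgroup ?M E by (rule sg)
  have c: "commutator E (a g) (b h) \<in> ?M" if "g \<in> carrier G" "h \<in> carrier G" for g h
    using that by (blast intro: generate.incl)
  show "?M \<subseteq> D"
  proof (rule E.generate_subgroup_incl)
    show "?C \<subseteq> D"
      by (auto simp: mem_kernels D_def p\<^sub>1.hom_commutator p\<^sub>2.hom_commutator commutator_def)
  qed (rule normal_imp_subgroup[OF D_normal])
  have conj_a: "a k \<otimes> m \<otimes> inv (a k) \<in> ?M" if k: "k \<in> carrier G" and m: "m \<in> ?C" for k m
  proof -
    obtain g h where gh: "g \<in> carrier G" "h \<in> carrier G" "m = commutator E (a g) (b h)"
      using m by auto
    have "a k \<otimes> m \<otimes> inv (a k) = commutator E (a (k \<otimes>\<^bsub>G\<^esub> g)) (b h) \<otimes> inv (commutator E (a k) (b h))"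
      unfolding gh(3) using k gh(1,2) E.conj_commutator_left by simp
    also have "\<dots> \<in> ?M"
      by (intro M.m_closed M.m_inv_closed c) (use gh(1,2) k in auto)
    finally show ?thesis .
  qed
  have conj_b: "b k \<otimes> m \<otimes> inv (b k) \<in> ?M" if k: "k \<in> carrier G" and m: "m \<in> ?C" for k m
  proof -
    obtain g h where "g \<in> carrier G" "h \<in> carrier G" "m = commutator E (a g) (b h)"
      using m by auto
    with conj_a[OF that] k show ?thesis by (simp add: a_conj_eq_b_conj)
  qed
  have conj: "x \<otimes> m \<otimes> inv x \<in> ?M"
    if x: "x \<in> a ` carrier G \<union> b ` carrier G" and m: "m \<in> ?M" for x m
  proof (rule E.conj_mem_generate[OF _ _ _ m])
    show "?C \<subseteq> carrier E" by auto
    show "x \<in> carrier E" using x by auto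
    show "x \<otimes> y \<otimes> inv x \<in> ?M" if "y \<in> ?C" for y
      using x conj_a[OF _ that] conj_b[OF _ that] by (elim UnE imageE) simp_all
  qed
  have normal_form: "\<exists>m\<in>?M. x = m \<otimes> (a (p\<^sub>1 x) \<otimes> b (p\<^sub>2 x))" if "x \<in> carrier E" for x
    using that
  proof (induction rule: carrier_induct)
    case (a g)
    then show ?case by (intro bexI[of _ \<one>]) auto
  next
    case (b g)
    then show ?case by (intro bexI[of _ \<one>]) auto
  next
    case (mult x y)
    then obtain m n where mn: "m \<in> ?M" "x = m \<otimes> (a (p\<^sub>1 x) \<otimes> b (p\<^sub>2 x))"
      "n \<in> ?M" "y = n \<otimes> (a (p\<^sub>1 y) \<otimes> b (p\<^sub>2 y))" by blast
    let ?g = "p\<^sub>1 x" and ?h = "p\<^sub>2 x" and ?g' = "p\<^sub>1 y" and ?h' = "p\<^sub>2 y"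
    have car: "?g \<in> carrier G" "?h \<in> carrier G" "?g' \<in> carrier G" "?h' \<in> carrier G"
      using mult by auto
    define u where "u = a ?g \<otimes> (b ?h \<otimes> n \<otimes> inv (b ?h)) \<otimes> inv (a ?g)"
    define v where "v = a ?g \<otimes> commutator E (b ?h) (a ?g') \<otimes> inv (a ?g)"
    have "u \<in> ?M" unfolding u_def by (intro conj) (use car mn in auto)
    \<comment> \<open>Moving a factor of the second copy past one of the first yields a commutator
      with the copies in the wrong order; the swap symmetry makes it a generator.\<close>
    moreover have "commutator E (b ?h) (a ?g') \<in> ?M"
      using car c by (simp flip: commutator_a_b_swap)
    then have "v \<in> ?M" unfolding v_def by (intro conj) (use car in auto)
    moreover have "x \<otimes> y = (m \<otimes> (a ?g \<otimes> b ?h)) \<otimes> (n \<otimes> (a ?g' \<otimes> b ?h'))"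
      by (rule arg_cong2[OF mn(2,4)])
    moreover have "\<dots> = (m \<otimes> u \<otimes> v) \<otimes> (a (p\<^sub>1 (x \<otimes> y)) \<otimes> b (p\<^sub>2 (x \<otimes> y)))"
      unfolding u_def v_def p\<^sub>1.hom_mult[OF mult(1,2)] p\<^sub>2.hom_mult[OF mult(1,2)]
        a.hom_mult[OF car(1,3)] b.hom_mult[OF car(2,4)]
      by (rule E.mult_products) (use car mn(1,3) in auto)
    ultimately show ?case
      using mn(1) by (intro bexI[of _ "m \<otimes> u \<otimes> v"] M.m_closed) simp_all
  qed
  show "D \<subseteq> ?M"
  proof
    fix x assume x: "x \<in> D"
    then have x: "x \<in> carrier E" "p\<^sub>1 x = \<one>\<^bsub>G\<^esub>" "p\<^sub>2 x = \<one>\<^bsub>G\<^esub>"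
      by (simp_all add: mem_kernels D_def)
    then obtain m where "m \<in> ?M" "x = m \<otimes> (a (p\<^sub>1 x) \<otimes> b (p\<^sub>2 x))"
      using normal_form by blast
    then show "x \<in> ?M" unfolding x(2,3) by simp
  qed
qed

text \<open>Conjugation by \<open>a k\<close> and by \<open>b k\<close> agree on the generators of
  \<open>D\<close>, so \<open>l k\<close> centralizes them. Passing to generated subgroups, first in
  \<open>D\<close> and then in \<open>L\<close>, gives the full statement.\<close>

lemma D_L_commute:
  assumes "d \<in> D" "x \<in> L"
  shows "commutator E d x = \<one>"
proof -
  let ?C = "{commutator E (a g) (b h) | g h. g \<in> carrier G \<and> h \<in> carrier G}"
  have 1: "commutator E c (l k) = \<one>" if k: "k \<in> carrier G" and c: "c \<in> ?C" for c k
  proof -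
    have cc: "c \<in> carrier E" using c by auto
    have "a k \<otimes> c \<otimes> inv (a k) = b k \<otimes> c \<otimes> inv (b k)"
      using c k a_conj_eq_b_conj by auto
    then have "inv (a k) \<otimes> (b k \<otimes> c \<otimes> inv (b k)) \<otimes> b k = c \<otimes> (inv (a k) \<otimes> b k)"
      using cc k by (simp add: E.m_assoc flip: \<open>a k \<otimes> c \<otimes> inv (a k) = b k \<otimes> c \<otimes> inv (b k)\<close>)
    moreover have "inv (a k) \<otimes> b k = l k"
      using k E.inv_comm[of "b k" "a k"] a_b_commute by (simp add: l_def)
    ultimately have "l k \<otimes> c = c \<otimes> l k"
      using cc k by (simp add: E.m_assoc) (simp flip: E.m_assoc)
    then show ?thesis
      using cc k by (simp add: E.commutator_eq_one_iff)
  qed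
  have 2: "D \<subseteq> centralizer_mod E (l ` carrier G) {\<one>}"
    unfolding D_generated
  proof (rule E.generate_subgroup_incl)
    show "subgroup (centralizer_mod E (l ` carrier G) {\<one>}) E"
      by (rule E.centralizer_mod_subgroup) (auto simp: E.one_is_normal)
    have "?C \<subseteq> carrier E" by auto
    with 1 show "?C \<subseteq> centralizer_mod E (l ` carrier G) {\<one>}"
      unfolding centralizer_mod_def by blast
  qed
  have 3: "L \<subseteq> centralizer_mod E D {\<one>}"
    unfolding L_generated
  proof (rule E.generate_subgroup_incl)
    show "subgroup (centralizer_mod E D {\<one>}) E"
      by (rule E.centralizer_mod_subgroup) (auto simp: E.one_is_normal E.normal_subset[OF D_normal])
    have "commutator E (l k) d = \<one>" if "k \<in> carrier G" "d \<in> D" for k d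
      using that 2 E.commutator_mem_swap[OF E.triv_subgroup, of d "l k"]
      unfolding centralizer_mod_def by auto
    then show "l ` carrier G \<subseteq> centralizer_mod E D {\<one>}"
      by (auto simp: centralizer_mod_def)
  qed
  show ?thesis
    using E.commutator_mem_swap[OF E.triv_subgroup, of x d] 3 assms E.normal_subset[OF D_normal]
    unfolding centralizer_mod_def by auto
qed

end

context group
begin

lemma commutator_subgroup_eq_derived: "commutator_subgroup G H H = derived G H"
  unfolding commutator_subgroup_def derived_def commutator_def
  by (rule arg_cong[of _ _ "generate G"]) auto

lemma commutator_in_derived:
  "x \<in> H \<Longrightarrow> y \<in> H \<Longrightarrow> commutator G x y \<in> derived G H"
  using commutator_in_commutator_subgroup[of x H y H] by (simp add: commutator_subgroup_eq_derived)

end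

section \<open>The subgroups filtering \<open>W\<close> and the links controlled by the whole
  group\<close>

context weak_commutativity
begin

definition L\<^sub>1 where "L\<^sub>1 = L \<inter> K\<^sub>2"
definition L\<^sub>2 where "L\<^sub>2 = L \<inter> K\<^sub>1"
text \<open>Described by \<open>p\<^sub>1\<close> so that normality is immediate. The condition is
  symmetric in the two copies, because \<open>p\<^sub>1\<close> and \<open>p\<^sub>2\<close> send
  \<open>l g\<close> to the inverse of \<open>g\<close> and to \<open>g\<close>.\<close>

definition L\<^sub>3 where "L\<^sub>3 = L \<inter> {x \<in> carrier E. p\<^sub>1 x \<in> derived G (carrier G)}"

abbreviation comms where "comms \<equiv> commutator_subgroup E"
abbreviation centr where "centr \<equiv> centralizer_mod E"

lemma derived_normal: "derived G (carrier G) \<lhd> G"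
  by (rule G.derived_is_normal[OF G.normal_carrier])

lemma L\<^sub>1_normal: "L\<^sub>1 \<lhd> E" and L\<^sub>2_normal: "L\<^sub>2 \<lhd> E" and L\<^sub>3_normal: "L\<^sub>3 \<lhd> E"
  unfolding L\<^sub>1_def L\<^sub>2_def L\<^sub>3_def
  by (intro E.normal_subgroup_intersect L_normal K\<^sub>1_normal K\<^sub>2_normal
      p\<^sub>1.normal_vimage[OF derived_normal])+

lemmas normals = L_normal D_normal W_normal K\<^sub>1_normal K\<^sub>2_normal L\<^sub>1_normal L\<^sub>2_normal L\<^sub>3_normal
  E.normal_carrier E.one_is_normal

lemma L_carrier: "x \<in> L \<Longrightarrow> x \<in> carrier E"
  by (rule E.normal_subset[OF L_normal])

lemma commutator_L: "x \<in> L \<Longrightarrow> y \<in> carrier E \<Longrightarrow> commutator E x y \<in> L"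
  "x \<in> L \<Longrightarrow> y \<in> carrier E \<Longrightarrow> commutator E y x \<in> L"
  by (simp_all add: E.commutator_mem_normal_left[OF L_normal] E.commutator_mem_normal_right[OF L_normal])

lemma W_L_commute: "w \<in> W \<Longrightarrow> x \<in> L \<Longrightarrow> commutator E w x = \<one>"
  by (simp add: W_def D_L_commute)

lemma derived_subset_p\<^sub>1_L\<^sub>1: "derived G (carrier G) \<subseteq> p\<^sub>1 ` L\<^sub>1"
proof -
  have "commutator G g h \<in> p\<^sub>1 ` L\<^sub>1" if "g \<in> carrier G" "h \<in> carrier G" for g h
  proof (rule image_eqI)
    \<comment> \<open>\<open>p\<^sub>1\<close> sends \<open>l k\<close> to the inverse of
      \<open>k\<close>, hence the inverse in the witness. The commutator lies in
      \<open>L\<^sub>1\<close> because \<open>p\<^sub>2\<close> kills \<open>a g\<close>.\<close>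
    show "commutator G g h = p\<^sub>1 (commutator E (a g) (l (inv\<^bsub>G\<^esub> h)))"
      using that by (simp add: p\<^sub>1.hom_commutator l_def)
    show "commutator E (a g) (l (inv\<^bsub>G\<^esub> h)) \<in> L\<^sub>1"
      using that commutator_L(2)[OF l_in_L]
      by (simp add: L\<^sub>1_def K\<^sub>2_def kernel_def p\<^sub>2.hom_commutator) (simp add: commutator_def)
  qed
  then show ?thesis
    unfolding G.commutator_subgroup_eq_derived[symmetric]
    by (intro G.commutator_subgroup_least p\<^sub>1.subgroup_img_is_subgroup
        normal_imp_subgroup[OF L\<^sub>1_normal])
qed

lemma derived_subset_p\<^sub>2_L\<^sub>2: "derived G (carrier G) \<subseteq> p\<^sub>2 ` L\<^sub>2"
proof -
  have "commutator G g h \<in> p\<^sub>2 ` L\<^sub>2" if "g \<in> carrier G" "h \<in> carrier G" for g h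
  proof (rule image_eqI)
    show "commutator G g h = p\<^sub>2 (commutator E (b g) (l h))"
      using that by (simp add: p\<^sub>2.hom_commutator l_def)
    show "commutator E (b g) (l h) \<in> L\<^sub>2"
      using that commutator_L(2)[OF l_in_L]
      by (simp add: L\<^sub>2_def K\<^sub>1_def kernel_def p\<^sub>1.hom_commutator) (simp add: commutator_def)
  qed
  then show ?thesis
    unfolding G.commutator_subgroup_eq_derived[symmetric]
    by (intro G.commutator_subgroup_least p\<^sub>2.subgroup_img_is_subgroup
        normal_imp_subgroup[OF L\<^sub>2_normal])
qed

text \<open>Since \<open>L\<^sub>1\<close> already maps onto the derived subgroup under
  \<open>p\<^sub>1\<close>, an element of \<open>L\<^sub>3\<close> can be corrected by one of
  \<open>L\<^sub>1\<close> so as to be killed by \<open>p\<^sub>1\<close>; the remainder is in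
  \<open>L\<^sub>2\<close>.\<close>

lemma L\<^sub>3_least:
  assumes M: "subgroup M E" and "L\<^sub>1 \<subseteq> M" "L\<^sub>2 \<subseteq> M"
  shows "L\<^sub>3 \<subseteq> M"
proof
  interpret L: subgroup L E by (rule normal_imp_subgroup[OF L_normal])
  fix x assume x: "x \<in> L\<^sub>3"
  then have xL: "x \<in> L" "x \<in> carrier E" "p\<^sub>1 x \<in> derived G (carrier G)" by (auto simp: L\<^sub>3_def)
  then obtain y where y: "y \<in> L\<^sub>1" "p\<^sub>1 y = p\<^sub>1 x"
    using derived_subset_p\<^sub>1_L\<^sub>1 by (metis (no_types, lifting) imageE subsetD)
  then have yc: "y \<in> L" "y \<in> carrier E" using L_carrier by (auto simp: L\<^sub>1_def)
  have "inv y \<otimes> x \<in> L\<^sub>2"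
    using xL yc y(2) by (simp add: L\<^sub>2_def K\<^sub>1_def kernel_def L.m_closed)
  then have "y \<otimes> (inv y \<otimes> x) \<in> M"
    using assms y by (blast intro: subgroup.m_closed)
  with xL yc show "x \<in> M" by simp
qed

lemma second_derived_subset: "derived G (derived G (carrier G)) \<subseteq> p\<^sub>2 ` comms L\<^sub>2 L\<^sub>2"
proof -
  have "derived G (derived G (carrier G)) \<subseteq> derived G (p\<^sub>2 ` L\<^sub>2)"
    by (rule G.mono_derived[OF derived_subset_p\<^sub>2_L\<^sub>2])
  also have "\<dots> = p\<^sub>2 ` comms L\<^sub>2 L\<^sub>2"
    unfolding E.commutator_subgroup_eq_derived
    by (rule p\<^sub>2.derived_img) (use E.normal_subset[OF L\<^sub>2_normal] in auto)
  finally show ?thesis .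
qed

definition U where "U = L\<^sub>2 \<inter> {x \<in> carrier E. p\<^sub>2 x \<in> derived G (derived G (carrier G))}"

lemma second_derived_normal: "derived G (derived G (carrier G)) \<lhd> G"
  by (rule G.derived_is_normal[OF derived_normal])

lemma U_normal: "U \<lhd> E"
  unfolding U_def
  by (intro E.normal_subgroup_intersect L\<^sub>2_normal p\<^sub>2.normal_vimage second_derived_normal)

text \<open>\<open>L\<^sub>2\<close> maps onto the derived subgroup under \<open>p\<^sub>2\<close>,
  so its commutators reach all of \<open>G''\<close>. Dividing by one of them leaves an element of
  \<open>L\<^sub>2\<close> killed by \<open>p\<^sub>2\<close>, that is, of \<open>W\<close>.\<close>

lemma U_least:
  assumes M: "subgroup M E" and W: "W \<subseteq> M" and L: "comms L\<^sub>2 L\<^sub>2 \<subseteq> M"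
  shows "U \<subseteq> M"
proof
  fix x assume "x \<in> U"
  then have x: "x \<in> L\<^sub>2" "x \<in> carrier E" "p\<^sub>2 x \<in> derived G (derived G (carrier G))"
    by (auto simp: U_def)
  then obtain z where z: "z \<in> comms L\<^sub>2 L\<^sub>2" "p\<^sub>2 z = p\<^sub>2 x"
    using second_derived_subset by (metis (no_types, lifting) imageE subsetD)
  interpret L2: subgroup L\<^sub>2 E by (rule normal_imp_subgroup[OF L\<^sub>2_normal])
  have zL: "z \<in> L\<^sub>2"
    using z(1) E.commutator_subgroup_least[OF L2.subgroup_axioms, of L\<^sub>2 L\<^sub>2]
      E.commutator_mem_normal_left[OF L\<^sub>2_normal] L2.mem_carrier by blast
  then have zc: "z \<in> carrier E" by simp
  have "x \<otimes> inv z \<in> L\<^sub>2" using x(1) zL by simp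
  then have "x \<otimes> inv z \<in> W"
    using x z zc by (simp add: W_def D_def L\<^sub>2_def K\<^sub>2_def kernel_def)
  then have "(x \<otimes> inv z) \<otimes> z \<in> M"
    using W L z(1) by (blast intro: subgroup.m_closed[OF M])
  with x zc show "x \<in> M" by (simp add: E.m_assoc)
qed

text \<open>\<open>L\<close> centralizes \<open>W\<close>, so the action of \<open>E\<close> on
  \<open>W\<close> factors through \<open>p\<^sub>3\<close>. This permits exchanging acting elements
  for more convenient ones.\<close>

lemma W_commutator_cong:
  assumes w: "w \<in> W" and x: "x \<in> carrier E" and y: "y \<in> carrier E" and eq: "p\<^sub>3 x = p\<^sub>3 y"
  shows "commutator E w x = commutator E w y"
proof -
  have wc: "w \<in> carrier E" by (rule E.normal_subset[OF W_normal w])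
  have m: "inv y \<otimes> x \<in> L"
    using x y eq by (simp add: L_def kernel_def)
  have "commutator E w (y \<otimes> (inv y \<otimes> x)) =
      commutator E w y \<otimes> (y \<otimes> commutator E w (inv y \<otimes> x) \<otimes> inv y)"
    using wc x y by (intro E.commutator_mult_right) auto
  with W_L_commute[OF w m] wc x y show ?thesis by simp
qed

lemma commutator_K\<^sub>1_K\<^sub>2: "x \<in> K\<^sub>1 \<Longrightarrow> y \<in> K\<^sub>2 \<Longrightarrow> commutator E x y \<in> D"
  by (simp add: D_def E.commutator_mem_normal_left[OF K\<^sub>1_normal]
      E.commutator_mem_normal_right[OF K\<^sub>2_normal] E.normal_subset[OF K\<^sub>1_normal]
      E.normal_subset[OF K\<^sub>2_normal])

lemma commutator_K\<^sub>2_K\<^sub>1: "x \<in> K\<^sub>2 \<Longrightarrow> y \<in> K\<^sub>1 \<Longrightarrow> commutator E x y \<in> D"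
  by (simp add: D_def E.commutator_mem_normal_left[OF K\<^sub>2_normal]
      E.commutator_mem_normal_right[OF K\<^sub>1_normal] E.normal_subset[OF K\<^sub>1_normal]
      E.normal_subset[OF K\<^sub>2_normal])

lemma K_carrier: "x \<in> K\<^sub>1 \<Longrightarrow> x \<in> carrier E" "x \<in> K\<^sub>2 \<Longrightarrow> x \<in> carrier E"
  by (simp_all add: mem_kernels)

text \<open>\<open>L\<^sub>1\<close> lies in \<open>K\<^sub>2\<close>, so its commutators with
  \<open>K\<^sub>1\<close> lie in \<open>D\<close>, which commutes with \<open>L\<close>. Both
  hypotheses of the three subgroups lemma hold with trivial target.\<close>

lemma comms_L\<^sub>1_L\<^sub>1: "comms L\<^sub>1 L\<^sub>1 \<subseteq> centr K\<^sub>1 {\<one>}"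
proof (rule E.three_subgroups[OF K\<^sub>1_normal L\<^sub>1_normal L\<^sub>1_normal E.one_is_normal])
  fix x y c assume "x \<in> L\<^sub>1" "y \<in> L\<^sub>1" "c \<in> K\<^sub>1"
  then show "commutator E (commutator E y c) x \<in> {\<one>}" "commutator E (commutator E c x) y \<in> {\<one>}"
    by (auto simp: L\<^sub>1_def commutator_K\<^sub>1_K\<^sub>2 commutator_K\<^sub>2_K\<^sub>1 intro!: D_L_commute)
qed

lemma comms_L\<^sub>2_L\<^sub>2: "comms L\<^sub>2 L\<^sub>2 \<subseteq> centr K\<^sub>2 {\<one>}"
proof (rule E.three_subgroups[OF K\<^sub>2_normal L\<^sub>2_normal L\<^sub>2_normal E.one_is_normal])
  fix x y c assume "x \<in> L\<^sub>2" "y \<in> L\<^sub>2" "c \<in> K\<^sub>2"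
  then show "commutator E (commutator E y c) x \<in> {\<one>}" "commutator E (commutator E c x) y \<in> {\<one>}"
    by (auto simp: L\<^sub>2_def commutator_K\<^sub>1_K\<^sub>2 commutator_K\<^sub>2_K\<^sub>1 intro!: D_L_commute)
qed

lemma commutator_L_L\<^sub>3:
  "x \<in> L \<Longrightarrow> y \<in> carrier E \<Longrightarrow> commutator E x y \<in> L\<^sub>3"
  "x \<in> L \<Longrightarrow> y \<in> carrier E \<Longrightarrow> commutator E y x \<in> L\<^sub>3"
  using L_carrier
  by (auto simp: L\<^sub>3_def commutator_L p\<^sub>1.hom_commutator intro!: G.commutator_in_derived)

lemma comms_normal: "A \<lhd> E \<Longrightarrow> B \<lhd> E \<Longrightarrow> comms A B \<lhd> E"
  by (rule E.commutator_subgroup_normal)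

text \<open>Top link of the filtration inside \<open>L'\<close>: commutators of \<open>L\<close>
  with any element fall into \<open>L\<^sub>3\<close>, so the three subgroups lemma applies with the
  whole group acting.\<close>

lemma comms_L_L: "comms L L \<subseteq> centr (carrier E) (comms L\<^sub>3 L)"
proof (rule E.three_subgroups[OF E.normal_carrier L_normal L_normal])
  show "comms L\<^sub>3 L \<lhd> E" by (intro comms_normal normals)
  fix x y c assume "x \<in> L" "y \<in> L" "c \<in> carrier E"
  then show "commutator E (commutator E y c) x \<in> comms L\<^sub>3 L"
    "commutator E (commutator E c x) y \<in> comms L\<^sub>3 L"
    by (auto intro: E.commutator_in_commutator_subgroup commutator_L_L\<^sub>3)
qed

lemma centr_swap:
  assumes N: "N \<lhd> E" and "A \<subseteq> carrier E" "B \<subseteq> centr A N"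
  shows "A \<subseteq> centr B N"
proof
  fix x assume x: "x \<in> A"
  show "x \<in> centr B N"
  proof (rule centralizer_modI)
    fix y assume "y \<in> B"
    then have "y \<in> carrier E" "commutator E y x \<in> N"
      using assms x by (auto simp: centralizer_mod_def)
    then show "commutator E x y \<in> N"
      using E.commutator_mem_swap[OF normal_imp_subgroup[OF N], of y x] assms x by auto
  qed (use assms x in auto)
qed

lemma comms_subset_centr: "comms A B \<subseteq> N \<Longrightarrow> A \<subseteq> carrier E \<Longrightarrow> A \<subseteq> centr B N"
  by (auto intro!: centralizer_modI E.commutator_in_commutator_subgroup)

text \<open>As \<open>L\<^sub>1\<close> and \<open>L\<^sub>2\<close> generate
  \<open>L\<^sub>3\<close>, it suffices to treat commutators among these two. Those within
  \<open>L\<^sub>1\<close> are centralized by \<open>K\<^sub>1\<close>, those within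
  \<open>L\<^sub>2\<close> by \<open>K\<^sub>2\<close>, and the mixed ones lie in the bottom
  term.\<close>

lemma comms_L\<^sub>3_L\<^sub>3:
  "comms L\<^sub>3 L\<^sub>3 \<subseteq> centr K\<^sub>1 (centr K\<^sub>2 (comms L\<^sub>2 L\<^sub>1))"
proof -
  let ?R = "comms L\<^sub>2 L\<^sub>1" let ?E1 = "centr K\<^sub>2 ?R" let ?E2 = "centr K\<^sub>1 ?E1"
  have R: "?R \<lhd> E" by (intro comms_normal normals)
  have E1: "?E1 \<lhd> E" by (intro E.centralizer_mod_normal normals R)
  have E2: "?E2 \<lhd> E" by (intro E.centralizer_mod_normal normals E1)
  have car: "L\<^sub>1 \<subseteq> carrier E" "L\<^sub>2 \<subseteq> carrier E" "L\<^sub>3 \<subseteq> carrier E" "K\<^sub>1 \<subseteq> carrier E" "K\<^sub>2 \<subseteq> carrier E"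
    using L_carrier K_carrier by (auto simp: L\<^sub>1_def L\<^sub>2_def L\<^sub>3_def)
  have RE1: "?R \<subseteq> ?E1" and E12: "?E1 \<subseteq> ?E2"
    by (intro E.subset_centralizer_mod R E1 car)+
  have one: "{\<one>} \<subseteq> N" if "N \<lhd> E" for N
    using normal_imp_subgroup[OF that] subgroup.one_closed by auto
  have 11: "comms L\<^sub>1 L\<^sub>1 \<subseteq> ?E2"
    using comms_L\<^sub>1_L\<^sub>1 E.centralizer_mod_mono[OF one[OF E1] order_refl] by blast
  have "comms L\<^sub>2 L\<^sub>2 \<subseteq> ?E1"
    using comms_L\<^sub>2_L\<^sub>2 E.centralizer_mod_mono[OF one[OF R] order_refl] by blast
  with E12 have 22: "comms L\<^sub>2 L\<^sub>2 \<subseteq> ?E2" by blast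
  from RE1 E12 have 21: "?R \<subseteq> ?E2" by blast
  have sg: "subgroup (centr B ?E2) E" if "B \<subseteq> carrier E" for B
    by (rule E.centralizer_mod_subgroup[OF that E2])
  \<comment> \<open>Generation by \<open>L\<^sub>1\<close> and \<open>L\<^sub>2\<close> can only be
    used in the left entry; swapping the entries afterwards allows the same for the other
    one.\<close>
  have "L\<^sub>3 \<subseteq> centr L\<^sub>1 ?E2"
    by (rule L\<^sub>3_least[OF sg[OF car(1)] comms_subset_centr[OF 11 car(1)] comms_subset_centr[OF 21 car(2)]])
  then have 13: "L\<^sub>1 \<subseteq> centr L\<^sub>3 ?E2" by (rule centr_swap[OF E2 car(1)])
  have "L\<^sub>1 \<subseteq> centr L\<^sub>2 ?E2"
    by (rule centr_swap[OF E2 car(1) comms_subset_centr[OF 21 car(2)]])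
  then have "L\<^sub>3 \<subseteq> centr L\<^sub>2 ?E2"
    by (rule L\<^sub>3_least[OF sg[OF car(2)] _ comms_subset_centr[OF 22 car(2)]])
  then have 23: "L\<^sub>2 \<subseteq> centr L\<^sub>3 ?E2" by (rule centr_swap[OF E2 car(2)])
  have "L\<^sub>3 \<subseteq> centr L\<^sub>3 ?E2"
    by (rule L\<^sub>3_least[OF sg[OF car(3)] 13 23])
  then show ?thesis
    by (intro E.commutator_subgroup_least normal_imp_subgroup[OF E2]) (auto dest: centralizer_modD)
qed

text \<open>Either of \<open>K\<^sub>1\<close> and \<open>K\<^sub>2\<close> contains one copy of
  \<open>G\<close> and so maps onto \<open>G\<close> under \<open>p\<^sub>3\<close>. On
  \<open>W\<close> it therefore induces the full action of \<open>E\<close>.\<close>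

lemma W_centr_carrier: 
  assumes "B \<in> {K\<^sub>1, K\<^sub>2}"
  shows "W \<inter> centr B N \<subseteq> centr (carrier E) N"
proof
  fix w assume w: "w \<in> W \<inter> centr B N"
  show "w \<in> centr (carrier E) N"
  proof (rule centralizer_modI)
    fix x assume x: "x \<in> carrier E"
    define y where "y = (if B = K\<^sub>1 then b (p\<^sub>3 x) else a (p\<^sub>3 x))"
    have "y \<in> B" "y \<in> carrier E" "p\<^sub>3 y = p\<^sub>3 x"
      using x assms by (auto simp: y_def mem_kernels)
    then show "commutator E w x \<in> N"
      using w x W_commutator_cong[of w x y] centralizer_modD by auto
  qed (use w E.normal_subset[OF W_normal] in auto)
qed

end

section \<open>Nilpotent action of \<open>Y\<close> on the part of \<open>W\<close> inside
  \<open>L'\<close>\<close>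

locale weak_commutativity_nilpotent = weak_commutativity E G a b p\<^sub>1 p\<^sub>2 p\<^sub>3
  for E :: "('x, 'm) monoid_scheme" (structure) and G :: "('g, 'n) monoid_scheme"
    and a b p\<^sub>1 p\<^sub>2 p\<^sub>3 +
  fixes K :: "'g set" and c :: nat
  assumes K_normal: "K \<lhd> G"
    and nilpotent: "carrier G \<subseteq> (centralizer_mod G K ^^ c) (derived G (derived G (carrier G)))"
begin

definition Y where "Y = {x \<in> carrier E. p\<^sub>3 x \<in> K}"
text \<open>Contains \<open>b g\<close> for all \<open>g \<in> K\<close>, so it induces the same
  action on \<open>W\<close> as \<open>Y\<close>. Being part of \<open>K\<^sub>1\<close>, it
  moreover moves elements of \<open>L\<close> only by elements of \<open>L\<^sub>2\<close>.\<close>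

definition Y\<^sub>2 where "Y\<^sub>2 = K\<^sub>1 \<inter> ({x \<in> carrier E. p\<^sub>2 x \<in> K} \<inter> Y)"

lemma Y_normal: "Y \<lhd> E"
  unfolding Y_def by (rule p\<^sub>3.normal_vimage[OF K_normal])

lemma Y\<^sub>2_normal: "Y\<^sub>2 \<lhd> E"
  unfolding Y\<^sub>2_def by (intro E.normal_subgroup_intersect normals p\<^sub>2.normal_vimage K_normal Y_normal)

text \<open>\<open>p\<^sub>2\<close> maps \<open>Y\<^sub>2\<close> into \<open>K\<close>, and
  \<open>U\<close> is the part of \<open>L\<^sub>2\<close> over \<open>G''\<close>, so the stages
  for \<open>K\<close> acting on \<open>G / G''\<close> pull back to
  \<open>L\<^sub>2\<close>.\<close>

lemma L\<^sub>2_subset: "L\<^sub>2 \<subseteq> (centr Y\<^sub>2 ^^ c) U"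
proof -
  have "L\<^sub>2 \<inter> {x \<in> carrier E. p\<^sub>2 x \<in> (centralizer_mod G K ^^ i) (derived G (derived G (carrier G)))}
      \<subseteq> (centr Y\<^sub>2 ^^ i) U" for i
  proof (induction i)
    case 0
    show ?case by (auto simp: U_def)
  next
    case (Suc i)
    show ?case
    proof
      fix x
      assume x: "x \<in> L\<^sub>2 \<inter> {x \<in> carrier E.
        p\<^sub>2 x \<in> (centralizer_mod G K ^^ Suc i) (derived G (derived G (carrier G)))}"
      have "x \<in> centr Y\<^sub>2 ((centr Y\<^sub>2 ^^ i) U)"
      proof (rule centralizer_modI)
        fix y assume "y \<in> Y\<^sub>2"
        then have y: "y \<in> carrier E" "p\<^sub>2 y \<in> K" by (auto simp: Y\<^sub>2_def)
        have "commutator E x y \<in> L\<^sub>2"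
          using x y by (intro E.commutator_mem_normal_left L\<^sub>2_normal) auto
        then show "commutator E x y \<in> (centr Y\<^sub>2 ^^ i) U"
          using x y by (intro subsetD[OF Suc]) (auto simp: p\<^sub>2.hom_commutator dest: centralizer_modD)
      qed (use x in auto)
      then show "x \<in> (centr Y\<^sub>2 ^^ Suc i) U" by simp
    qed
  qed
  from this[of c] show ?thesis
    using nilpotent E.normal_subset[OF L\<^sub>2_normal] by fastforce
qed

text \<open>Commutators of \<open>L\<close> with \<open>Y\<^sub>2\<close> are killed by
  \<open>p\<^sub>1\<close> and hence fall into \<open>L\<^sub>2\<close>, which accounts for the one
  extra stage.\<close>

lemma L_subset: "L \<subseteq> (centr Y\<^sub>2 ^^ Suc c) U"
proof
  fix x assume x: "x \<in> L"
  have "x \<in> centr Y\<^sub>2 ((centr Y\<^sub>2 ^^ c) U)"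
  proof (rule centralizer_modI)
    fix y assume "y \<in> Y\<^sub>2"
    then have y: "y \<in> K\<^sub>1" "y \<in> carrier E" by (auto simp: Y\<^sub>2_def)
    have "commutator E x y \<in> L\<^sub>2"
      using x y L_carrier by (simp add: L\<^sub>2_def commutator_L E.commutator_mem_normal_right[OF K\<^sub>1_normal])
    then show "commutator E x y \<in> (centr Y\<^sub>2 ^^ c) U" using L\<^sub>2_subset by blast
  qed (use x L_carrier in auto)
  then show "x \<in> (centr Y\<^sub>2 ^^ Suc c) U" by simp
qed

text \<open>The transfer lemma pairs \<open>L\<^sub>3\<close> with \<open>L\<close>. Commutators of
  \<open>L\<close> with \<open>Y\<^sub>2\<close> are in \<open>L\<^sub>3\<close>, and those of
  \<open>U\<close> with \<open>L\<close> are harmless because \<open>U\<close> is generated by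
  \<open>W\<close>, which commutes with \<open>L\<close>, and by commutators of
  \<open>L\<^sub>2\<close>.\<close>

lemma comms_L\<^sub>3_L: "comms L\<^sub>3 L \<subseteq> (centr Y\<^sub>2 ^^ Suc c) (comms L\<^sub>3 L\<^sub>3)"
proof -
  have L3: "L\<^sub>3 \<inter> (centr Y\<^sub>2 ^^ Suc c) U = L\<^sub>3"
    using L_subset unfolding L\<^sub>3_def by blast
  have N: "comms L\<^sub>3 L\<^sub>3 \<lhd> E" by (intro comms_normal normals)
  have U: "U \<subseteq> centr L (comms L\<^sub>3 L\<^sub>3)"
  proof (rule U_least)
    show "subgroup (centr L (comms L\<^sub>3 L\<^sub>3)) E"
      using L_carrier by (intro E.centralizer_mod_subgroup N) auto
    show "W \<subseteq> centr L (comms L\<^sub>3 L\<^sub>3)"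
      using normal_imp_subgroup[OF N] E.normal_subset[OF W_normal]
      by (auto intro!: centralizer_modI simp: W_L_commute subgroup.one_closed)
    have "L\<^sub>2 \<subseteq> L\<^sub>3"
      using L_carrier subgroup.one_closed[OF normal_imp_subgroup[OF derived_normal]]
      by (auto simp: L\<^sub>2_def L\<^sub>3_def K\<^sub>1_def kernel_def)
    then have "comms L\<^sub>2 L\<^sub>2 \<subseteq> comms L\<^sub>3 L\<^sub>3"
      by (intro E.commutator_subgroup_least normal_imp_subgroup[OF N]
          E.commutator_in_commutator_subgroup) auto
    also have "\<dots> \<subseteq> centr L (comms L\<^sub>3 L\<^sub>3)"
      using L_carrier by (intro E.subset_centralizer_mod N) auto
    finally show "comms L\<^sub>2 L\<^sub>2 \<subseteq> centr L (comms L\<^sub>3 L\<^sub>3)" .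
  qed
  have "comms (L\<^sub>3 \<inter> (centr Y\<^sub>2 ^^ Suc c) U) L \<subseteq> (centr Y\<^sub>2 ^^ Suc c) (comms L\<^sub>3 L\<^sub>3)"
  proof (rule E.commutator_in_funpow_centralizer_mod[OF L\<^sub>3_normal L_normal Y\<^sub>2_normal U_normal N])
    fix t y s assume "t \<in> L" "y \<in> Y\<^sub>2" "s \<in> L\<^sub>3"
    then show "commutator E (commutator E t y) s \<in> comms L\<^sub>3 L\<^sub>3"
      using E.normal_subset[OF Y\<^sub>2_normal]
      by (intro E.commutator_in_commutator_subgroup commutator_L_L\<^sub>3)
  next
    fix s t assume "s \<in> U" "t \<in> L"
    then show "commutator E s t \<in> comms L\<^sub>3 L\<^sub>3" by (rule centralizer_modD[OF subsetD[OF U]])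
  qed
  then show ?thesis unfolding L3 .
qed

text \<open>Here the pairing is between \<open>L\<^sub>2\<close> and \<open>L\<^sub>1\<close> with
  trivial target: commutators of \<open>L\<^sub>1\<close> with \<open>Y\<^sub>2\<close> lie in
  \<open>D\<close> and commute with \<open>L\<^sub>2\<close>, while \<open>U\<close> commutes with
  \<open>L\<^sub>1\<close>.\<close>

lemma comms_L\<^sub>2_L\<^sub>1: "comms L\<^sub>2 L\<^sub>1 \<subseteq> (centr Y\<^sub>2 ^^ c) {\<one>}"
proof -
  have L2: "L\<^sub>2 \<inter> (centr Y\<^sub>2 ^^ c) U = L\<^sub>2"
    using L\<^sub>2_subset by blast
  have U: "U \<subseteq> centr L\<^sub>1 {\<one>}"
  proof (rule U_least)
    show "subgroup (centr L\<^sub>1 {\<one>}) E"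
      using E.normal_subset[OF L\<^sub>1_normal] by (intro E.centralizer_mod_subgroup normals) auto
    show "W \<subseteq> centr L\<^sub>1 {\<one>}"
      using E.normal_subset[OF W_normal] by (auto intro!: centralizer_modI simp: W_L_commute L\<^sub>1_def)
    have "centr K\<^sub>2 {\<one>} \<subseteq> centr L\<^sub>1 {\<one>}"
      by (intro E.centralizer_mod_mono) (auto simp: L\<^sub>1_def)
    with comms_L\<^sub>2_L\<^sub>2 show "comms L\<^sub>2 L\<^sub>2 \<subseteq> centr L\<^sub>1 {\<one>}" by blast
  qed
  have "comms (L\<^sub>2 \<inter> (centr Y\<^sub>2 ^^ c) U) L\<^sub>1 \<subseteq> (centr Y\<^sub>2 ^^ c) {\<one>}"
  proof (rule E.commutator_in_funpow_centralizer_mod[OF L\<^sub>2_normal L\<^sub>1_normal Y\<^sub>2_normal U_normal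
        E.one_is_normal])
    fix t y s assume "t \<in> L\<^sub>1" "y \<in> Y\<^sub>2" "s \<in> L\<^sub>2"
    then show "commutator E (commutator E t y) s \<in> {\<one>}"
      using commutator_K\<^sub>2_K\<^sub>1[of t y] D_L_commute[of "commutator E t y" s]
      by (simp add: L\<^sub>1_def L\<^sub>2_def Y\<^sub>2_def)
  next
    fix s t assume "s \<in> U" "t \<in> L\<^sub>1"
    then show "commutator E s t \<in> {\<one>}" by (rule centralizer_modD[OF subsetD[OF U]])
  qed
  then show ?thesis unfolding L2 .
qed

text \<open>On \<open>W\<close> an element \<open>y\<close> of \<open>Y\<close> acts as
  \<open>b (p\<^sub>3 y)\<close>, which belongs to \<open>Y\<^sub>2\<close>.\<close>

lemma W_centr_Y\<^sub>2: "W \<inter> (centr Y\<^sub>2 ^^ i) N \<subseteq> (centr Y ^^ i) N"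
proof (induction i)
  case (Suc i)
  show ?case
  proof
    fix w assume w: "w \<in> W \<inter> (centr Y\<^sub>2 ^^ Suc i) N"
    then have wc: "w \<in> carrier E" using E.normal_subset[OF W_normal] by blast
    have "w \<in> centr Y ((centr Y ^^ i) N)"
    proof (rule centralizer_modI)
      fix y assume y: "y \<in> Y"
      then have yc: "y \<in> carrier E" "b (p\<^sub>3 y) \<in> Y\<^sub>2" by (auto simp: Y_def Y\<^sub>2_def mem_kernels)
      then have eq: "commutator E w y = commutator E w (b (p\<^sub>3 y))"
        using w by (intro W_commutator_cong) auto
      have "commutator E w (b (p\<^sub>3 y)) \<in> W \<inter> (centr Y\<^sub>2 ^^ i) N"
        using w yc E.commutator_mem_normal_left[OF W_normal] by (auto simp: centralizer_mod_def)
      then show "commutator E w y \<in> (centr Y ^^ i) N" unfolding eq using Suc by blast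
    qed (rule wc)
    then show "w \<in> (centr Y ^^ Suc i) N" by simp
  qed
qed simp

lemma W_comms_L_L: "\<exists>n. W \<inter> comms L L \<subseteq> (centr Y ^^ n) {\<one>}"
proof -
  have Y: "Y \<subseteq> carrier E" by (auto simp: Y_def)
  note compose = E.funpow_centralizer_mod_compose[OF W_normal Y]
  have Yc: "centr (carrier E) N \<subseteq> (centr Y ^^ 1) N" for N
    using E.centralizer_mod_mono[OF order_refl Y] by simp
  have "W \<inter> comms L L \<subseteq> (centr Y ^^ 1) (comms L\<^sub>3 L)"
    using comms_L_L Yc by blast
  moreover have "W \<inter> comms L\<^sub>3 L \<subseteq> (centr Y ^^ Suc c) (comms L\<^sub>3 L\<^sub>3)"
    using comms_L\<^sub>3_L W_centr_Y\<^sub>2 by blast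
  \<comment> \<open>This link takes two stages, one for \<open>K\<^sub>1\<close> and one for
    \<open>K\<^sub>2\<close>; on \<open>W\<close> each counts as a stage for all of
    \<open>E\<close>.\<close>
  moreover have "W \<inter> comms L\<^sub>3 L\<^sub>3 \<subseteq> (centr Y ^^ 1) (centr K\<^sub>2 (comms L\<^sub>2 L\<^sub>1))"
    using comms_L\<^sub>3_L\<^sub>3 W_centr_carrier[of K\<^sub>1] Yc by blast
  moreover have "W \<inter> centr K\<^sub>2 (comms L\<^sub>2 L\<^sub>1) \<subseteq> (centr Y ^^ 1) (comms L\<^sub>2 L\<^sub>1)"
    using W_centr_carrier[of K\<^sub>2] Yc by blast
  moreover have "W \<inter> comms L\<^sub>2 L\<^sub>1 \<subseteq> (centr Y ^^ c) {\<one>}"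
    using comms_L\<^sub>2_L\<^sub>1 W_centr_Y\<^sub>2 by blast
  ultimately show ?thesis by (meson compose)
qed

end

section \<open>The action on the abelianization of \<open>L\<close>\<close>

context weak_commutativity
begin

abbreviation L' where "L' \<equiv> comms L L"
abbreviation L_centr where "L_centr \<equiv> centr L L'"

lemma L'_normal: "L' \<lhd> E"
  by (intro comms_normal normals)

lemma L_centr_normal: "L_centr \<lhd> E"
  by (intro E.centralizer_mod_normal normals L'_normal)

lemma L_subset_L_centr: "L \<subseteq> L_centr"
  by (rule comms_subset_centr) (auto simp: L_carrier)

lemma D_subset_L_centr: "D \<subseteq> L_centr"
  using D_L_commute E.normal_subset[OF D_normal] normal_imp_subgroup[OF L'_normal]
  by (auto intro!: centralizer_modI simp: subgroup.one_closed)

lemma carrier_decompose: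
  assumes "x \<in> carrier E"
  shows "\<exists>m\<in>L. x = m \<otimes> a (p\<^sub>3 x)" "\<exists>m\<in>L. x = m \<otimes> b (p\<^sub>3 x)"
proof -
  show "\<exists>m\<in>L. x = m \<otimes> a (p\<^sub>3 x)"
    using assms by (intro bexI[of _ "x \<otimes> inv (a (p\<^sub>3 x))"]) (auto simp: E.m_assoc L_def kernel_def)
  show "\<exists>m\<in>L. x = m \<otimes> b (p\<^sub>3 x)"
    using assms by (intro bexI[of _ "x \<otimes> inv (b (p\<^sub>3 x))"]) (auto simp: E.m_assoc L_def kernel_def)
qed

text \<open>\<open>E\<close> acts on \<open>L / L'\<close> through an abelian group. Splitting
  \<open>x\<close> along the first copy and \<open>y\<close> along the second reduces the
  commutator, modulo \<open>L\<close>, to a generator of \<open>D\<close>, and both \<open>L\<close>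
  and \<open>D\<close> act trivially on \<open>L / L'\<close>.\<close>

lemma commutator_mem_L_centr:
  assumes x: "x \<in> carrier E" and y: "y \<in> carrier E"
  shows "commutator E x y \<in> L_centr"
proof -
  interpret N: normal L_centr E by (rule L_centr_normal)
  obtain m where m: "m \<in> L" "x = m \<otimes> a (p\<^sub>3 x)"
    using carrier_decompose x by blast
  obtain n where n: "n \<in> L" "y = n \<otimes> b (p\<^sub>3 y)"
    using carrier_decompose y by blast
  let ?g = "a (p\<^sub>3 x)" and ?h = "b (p\<^sub>3 y)"
  have car: "m \<in> carrier E" "n \<in> carrier E" "?g \<in> carrier E" "?h \<in> carrier E"
    using m(1) n(1) x y L_carrier by auto
  have mem: "m \<in> L_centr" "n \<in> L_centr" using m(1) n(1) L_subset_L_centr by auto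
  have "commutator E ?g ?h \<in> D"
    unfolding D_generated
    by (rule generate.incl, rule CollectI, rule exI[of _ "p\<^sub>3 x"], rule exI[of _ "p\<^sub>3 y"])
      (simp add: x y)
  then have gh: "commutator E ?g ?h \<in> L_centr" using D_subset_L_centr by blast
  have "commutator E ?g (n \<otimes> ?h) = commutator E ?g n \<otimes> (n \<otimes> commutator E ?g ?h \<otimes> inv n)"
    by (rule E.commutator_mult_right[OF car(3,2,4)])
  then have gy: "commutator E ?g y \<in> L_centr"
    using N.m_closed[OF E.commutator_mem_normal_right[OF L_centr_normal car(3) mem(2)]
        N.inv_op_closed2[OF car(2) gh]] unfolding n(2)[symmetric] by simp
  have "commutator E (m \<otimes> ?g) y = m \<otimes> commutator E ?g y \<otimes> inv m \<otimes> commutator E m y"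
    by (rule E.commutator_mult_left[OF car(1,3) y])
  then show ?thesis
    using N.m_closed[OF N.inv_op_closed2[OF car(1) gy]
        E.commutator_mem_normal_left[OF L_centr_normal mem(1) y]] unfolding m(2)[symmetric] by simp
qed

text \<open>Acting elements may be altered by a factor from \<open>L_centr\<close>, as they then act
  in the same way on \<open>L / L'\<close> and on its quotients.\<close>

lemma commutator_L_centr_mult:
  assumes M: "M \<lhd> E" "L' \<subseteq> M" and x: "x \<in> L" and e: "e \<in> L_centr" and z: "z \<in> carrier E"
  shows "commutator E x (e \<otimes> z) \<in> M \<longleftrightarrow> commutator E x z \<in> M"
proof -
  interpret M: normal M E by (rule M)
  have car: "x \<in> carrier E" "e \<in> carrier E"
    using x L_carrier E.normal_subset[OF L_centr_normal e] by auto
  have "commutator E e x \<in> L'" using e x by (rule centralizer_modD)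
  then have xe: "commutator E x e \<in> M"
    using M(2) E.commutator_mem_swap[OF M.subgroup_axioms car(2,1)] by blast
  have eq: "commutator E x (e \<otimes> z) = commutator E x e \<otimes> (e \<otimes> commutator E x z \<otimes> inv e)"
    by (rule E.commutator_mult_right[OF car z])
  show ?thesis
  proof
    assume "commutator E x z \<in> M"
    then show "commutator E x (e \<otimes> z) \<in> M"
      unfolding eq by (intro M.m_closed xe M.inv_op_closed2 car)
  next
    assume *: "commutator E x (e \<otimes> z) \<in> M"
    have "inv e \<otimes> (inv (commutator E x e) \<otimes> commutator E x (e \<otimes> z)) \<otimes> e \<in> M"
      by (intro M.inv_op_closed1 M.m_closed M.m_inv_closed xe * car)
    also have "inv e \<otimes> (inv (commutator E x e) \<otimes> commutator E x (e \<otimes> z)) \<otimes> e = commutator E x z"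
      unfolding eq using car z by (simp add: E.m_assoc)
    finally show "commutator E x z \<in> M" .
  qed
qed

definition fixed_by where "fixed_by z = L \<inter> centr {z} L'"

lemma fixed_by_iff: "x \<in> fixed_by z \<longleftrightarrow> x \<in> L \<and> commutator E x z \<in> L'"
  using L_carrier by (auto simp: fixed_by_def centralizer_mod_def)

text \<open>The action on \<open>L / L'\<close> is abelian, so conjugates of \<open>z\<close> have
  the same fixed points as \<open>z\<close>.\<close>

lemma fixed_by_normal:
  assumes z: "z \<in> carrier E"
  shows "fixed_by z \<lhd> E"
proof (rule E.normal_invI)
  show "subgroup (fixed_by z) E"
    unfolding fixed_by_def using z
    by (intro E.subgroups_Inter_pair normal_imp_subgroup[OF L_normal] E.centralizer_mod_subgroup L'_normal)
      auto
next
  fix y x assume y: "y \<in> carrier E" and "x \<in> fixed_by z"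
  then have x: "x \<in> L" "commutator E x z \<in> L'" "x \<in> carrier E"
    using L_carrier by (auto simp: fixed_by_iff)
  \<comment> \<open>The product on the right is the conjugate
    \<open>inv y \<otimes> z \<otimes> y\<close>, written so that it visibly differs from
    \<open>z\<close> by an element of \<open>L_centr\<close>.\<close>
  have "commutator E x (commutator E (inv y) z \<otimes> z) \<in> L'"
    using commutator_L_centr_mult[OF L'_normal order_refl x(1) commutator_mem_L_centr z] x y z by simp
  then have "y \<otimes> commutator E x (commutator E (inv y) z \<otimes> z) \<otimes> inv y \<in> L'"
    by (intro E.conj_mem_normal[OF L'_normal] y)
  also have "y \<otimes> commutator E x (commutator E (inv y) z \<otimes> z) \<otimes> inv y = commutator E (y \<otimes> x \<otimes> inv y) z"
    using E.conj_commutator[of x "commutator E (inv y) z \<otimes> z" y] x y z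
    by (simp add: commutator_def E.m_assoc)
  finally show "y \<otimes> x \<otimes> inv y \<in> fixed_by z"
    using x y E.conj_mem_normal[OF L_normal] by (simp add: fixed_by_iff)
qed

lemma L'_subset_fixed_by:
  assumes "z \<in> carrier E"
  shows "L' \<subseteq> fixed_by z"
proof
  fix x assume x: "x \<in> L'"
  have "L' \<subseteq> L"
    by (rule E.commutator_subgroup_least[OF normal_imp_subgroup[OF L_normal]])
      (simp add: commutator_L L_carrier)
  with x assms show "x \<in> fixed_by z"
    by (auto simp: fixed_by_iff intro: E.commutator_mem_normal_left[OF L'_normal])
qed

text \<open>On the abelianization of \<open>L\<close>, every \<open>g\<close> acts with \<open>(g - 1)\<^sup>2 = 0\<close>: the element \<open>l k\<close> is
  fixed by \<open>k = h g h\<^sup>-\<^sup>1\<close>, which acts as \<open>g\<close> does, and expanding \<open>l (h g) = l (k h)\<close> by the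
  derivation rule expresses \<open>(k - 1) l h\<close> through \<open>l k\<close> and a conjugate of \<open>l g\<close>.\<close>

lemma commutator_l_fixed:
  assumes g: "g \<in> carrier G" and h: "h \<in> carrier G"
  shows "commutator E (l h) (a g) \<in> fixed_by (a g)"
proof -
  let ?F = "fixed_by (a g)"
  have Fn: "?F \<lhd> E" using g by (intro fixed_by_normal) auto
  interpret F: normal ?F E by (rule Fn)
  have L'F: "L' \<subseteq> ?F" using g by (intro L'_subset_fixed_by) auto
  define k where "k = h \<otimes>\<^bsub>G\<^esub> g \<otimes>\<^bsub>G\<^esub> inv\<^bsub>G\<^esub> h"
  define e where "e = commutator E (a h) (a g)"
  have k: "k \<in> carrier G" using g h by (simp add: k_def)
  have kh: "k \<otimes>\<^bsub>G\<^esub> h = h \<otimes>\<^bsub>G\<^esub> g" using g h by (simp add: k_def G.m_assoc)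
  have ak: "a k = e \<otimes> a g"
    using g h by (simp add: k_def e_def commutator_def E.m_assoc)
  have e: "e \<in> L_centr" unfolding e_def using g h by (intro commutator_mem_L_centr) auto
  have mem_F: "x \<in> ?F" if "x \<in> L" "x \<otimes> a j = a j \<otimes> x" "a j = f \<otimes> a g" "f \<in> L_centr" "j \<in> carrier G"
    for x j f
  proof -
    have "commutator E x (a j) = \<one>"
      using E.commutator_eq_one_iff[OF L_carrier[OF that(1)] a.hom_closed[OF that(5)]] that(2) by simp
    then have "commutator E x (f \<otimes> a g) \<in> L'"
      using that(3) subgroup.one_closed[OF normal_imp_subgroup[OF L'_normal]] by simp
    then show ?thesis
      using that g commutator_L_centr_mult[OF L'_normal order_refl] by (simp add: fixed_by_iff)
  qed
  have lk: "l k \<in> ?F"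
    by (rule mem_F[OF l_in_L[OF k] l_commutes_a[OF k] ak e k])
  have "\<one> \<in> L_centr" by (rule subgroup.one_closed[OF normal_imp_subgroup[OF L_centr_normal]])
  then have lg: "l g \<in> ?F"
    using g by (intro mem_F[OF l_in_L[OF g] l_commutes_a[OF g] _ _ g, of \<one>]) auto
  define n where "n = a h \<otimes> l g \<otimes> inv (a h)"
  have nF: "n \<in> ?F" unfolding n_def using lg h by (intro F.inv_op_closed2) auto
  have car: "n \<in> carrier E" "l k \<in> carrier E" "l h \<in> carrier E" "a k \<in> carrier E" "a g \<in> carrier E"
    using nF k h g by auto
  have "l h \<otimes> n = l (h \<otimes>\<^bsub>G\<^esub> g)"
    unfolding n_def using g h by (simp add: conj_l)
  also have "\<dots> = l k \<otimes> (a k \<otimes> l h \<otimes> inv (a k))"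
    unfolding kh[symmetric] using k h by (simp add: conj_l)
  finally have "inv (l k) \<otimes> (l h \<otimes> n) = a k \<otimes> l h \<otimes> inv (a k)"
    using k h by simp
  then have "commutator E (a k) (l h) = inv (l k) \<otimes> (l h \<otimes> n \<otimes> inv (l h))"
    using car by (simp add: commutator_def flip: E.m_assoc)
  also have "\<dots> \<in> ?F" by (intro F.m_closed F.m_inv_closed F.inv_op_closed2 lk nF car)
  finally have "commutator E (l h) (a k) \<in> ?F"
    by (rule E.commutator_mem_swap[OF F.subgroup_axioms car(4,3)])
  then show ?thesis
    unfolding ak using commutator_L_centr_mult[OF Fn L'F l_in_L[OF h] e car(5)] by simp
qed

lemma commutator_fixed:
  assumes "x \<in> L" "g \<in> carrier G"
  shows "commutator E x (a g) \<in> fixed_by (a g)"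
proof -
  have "L \<subseteq> centr {a g} (fixed_by (a g))"
    unfolding L_generated
  proof (rule E.generate_subgroup_incl)
    show "l ` carrier G \<subseteq> centr {a g} (fixed_by (a g))"
      using assms commutator_l_fixed by (auto intro!: centralizer_modI)
    show "subgroup (centr {a g} (fixed_by (a g))) E"
      using assms by (intro E.centralizer_mod_subgroup fixed_by_normal) auto
  qed
  with assms show ?thesis by (blast intro: centralizer_modD)
qed

text \<open>Commuting with \<open>a s\<close> makes an element fixed by \<open>s\<close>, as
  \<open>(s - 1)\<^sup>2 = 0\<close>, and keeps the fixed points already gained, as these form
  normal subgroups. Thus each generator needs to be used at most once.\<close>

lemma L_nilpotent_mod_L':
  assumes S: "finite S" "S \<subseteq> carrier G" "generate G S = carrier G"
  shows "L \<subseteq> (centr (carrier E) ^^ Suc (card S)) L'"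
proof -
  let ?Z = "\<lambda>i. (centr (carrier E) ^^ i) L'"
  have Zn: "?Z i \<lhd> E" for i
    by (intro E.funpow_centralizer_mod_normal normals L'_normal)
  have LZ: "L' \<subseteq> ?Z i" for i
    by (intro E.subset_funpow_centralizer_mod normals L'_normal)
  \<comment> \<open>\<open>T\<close> holds the generators that may still move \<open>x\<close>
    modulo \<open>L'\<close>. For empty \<open>T\<close> one stage remains, whence the
    successor.\<close>
  have "x \<in> ?Z (Suc (card T))"
    if "T \<subseteq> S" "x \<in> L" "\<And>t. t \<in> S - T \<Longrightarrow> x \<in> fixed_by (a t)" for T x
  proof -
    have "finite T" using that(1) S(1) finite_subset by blast
    then show ?thesis
      using that
    proof (induction "card T" arbitrary: T x rule: less_induct)
      case less
      let ?M = "?Z (card T)"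
      have x: "x \<in> carrier E" using less.prems(3) by (rule L_carrier)
      have sg: "subgroup (centr {x} ?M) E"
        by (rule E.centralizer_mod_subgroup[OF _ Zn]) (use x in auto)
      have gen: "commutator E x (a s) \<in> ?M" if s: "s \<in> S" for s
      proof (cases "s \<in> T")
        case False
        then have "commutator E x (a s) \<in> L'" using less.prems(4) s by (simp add: fixed_by_iff)
        then show ?thesis using LZ by blast
      next
        case True
        have sc: "s \<in> carrier G" "a s \<in> carrier E" using s S(2) by auto
        have "commutator E x (a s) \<in> fixed_by (a t)" if "t \<in> S - (T - {s})" for t
        proof (cases "t = s")
          case True
          then show ?thesis using commutator_fixed[OF less.prems(3) sc(1)] by simp
        next
          case False
          then have "x \<in> fixed_by (a t)" "a t \<in> carrier E" using less.prems(4) that S(2) by auto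
          then show ?thesis
            using E.commutator_mem_normal_left[OF fixed_by_normal _ sc(2)] by blast
        qed
        moreover have "card (T - {s}) < card T"
          by (rule card_Diff1_less[OF less.prems(1) True])
        ultimately have "commutator E x (a s) \<in> ?Z (Suc (card (T - {s})))"
          using less.hyps[of "T - {s}" "commutator E x (a s)"] less.prems(1-3) commutator_L(1) sc(2)
          by blast
        then show ?thesis using card.remove[OF less.prems(1) True] by simp
      qed
      \<comment> \<open>Acting elements form a subgroup when placed in the left entry, so the
        commutator is turned round before generators of \<open>E\<close> are used.\<close>
      have swap: "y \<in> centr {x} ?M \<longleftrightarrow> commutator E x y \<in> ?M" if "y \<in> carrier E" for y
        using E.commutator_mem_swap[OF normal_imp_subgroup[OF Zn] that x]
          E.commutator_mem_swap[OF normal_imp_subgroup[OF Zn] x that] that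
        by (auto simp: centralizer_mod_def)
      have "a ` S \<subseteq> centr {x} ?M"
        using gen swap S(2) by auto
      then have "generate E (a ` S) \<subseteq> centr {x} ?M"
        by (rule E.generate_subgroup_incl[OF _ sg])
      then have a_car: "a ` carrier G \<subseteq> centr {x} ?M"
        using a.generate_img[OF S(2)] S(3) by simp
      have L_car: "L \<subseteq> centr {x} ?M"
      proof
        fix m assume "m \<in> L"
        then have "m \<in> carrier E" "commutator E x m \<in> L'"
          using less.prems(3) by (auto simp: L_carrier intro: E.commutator_in_commutator_subgroup)
        then show "m \<in> centr {x} ?M" using swap LZ by blast
      qed
      have "commutator E x y \<in> ?M" if y: "y \<in> carrier E" for y
      proof -
        obtain m where m: "m \<in> L" "y = m \<otimes> a (p\<^sub>3 y)" using carrier_decompose(1)[OF y] by blast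
        have "m \<otimes> a (p\<^sub>3 y) \<in> centr {x} ?M"
          by (rule subgroup.m_closed[OF sg]) (use m(1) y L_car a_car in auto)
        then show ?thesis unfolding m(2)[symmetric] swap[OF y] .
      qed
      then show ?case using x by (auto intro!: centralizer_modI)
    qed
  qed
  from this[of S] show ?thesis by auto
qed

end

section \<open>Subgroups of finite index\<close>

context group
begin

lemma rcosets_eq_image: "rcosets H = (\<lambda>x. H #> x) ` carrier G"
  by (auto simp: RCOSETS_def)

text \<open>The labelling \<open>c\<close> is left free: below it is the permutation of cosets
  induced by \<open>x\<close>, or the coset of the image of \<open>x\<close>.\<close>

lemma finite_rcosetsI:
  assumes H: "subgroup H G" and fin: "finite (c ` carrier G)"
    and c: "\<And>x y. x \<in> carrier G \<Longrightarrow> y \<in> carrier G \<Longrightarrow> c x = c y \<Longrightarrow> x \<otimes> inv y \<in> H"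
  shows "finite (rcosets H)"
proof -
  have "H #> x = H #> inv_into (carrier G) c (c x)" if x: "x \<in> carrier G" for x
  proof -
    let ?y = "inv_into (carrier G) c (c x)"
    have y: "?y \<in> carrier G" "c x = c ?y"
      using x by (simp_all add: inv_into_into f_inv_into_f)
    have "x = (x \<otimes> inv ?y) \<otimes> ?y" using x y(1) by (simp add: m_assoc)
    then have "x \<in> H #> ?y" using c[OF x y] by (auto simp: r_coset_def)
    then show ?thesis using repr_independence[OF _ y(1) H] by simp
  qed
  then have "rcosets H \<subseteq> (\<lambda>v. H #> inv_into (carrier G) c v) ` (c ` carrier G)"
    unfolding rcosets_eq_image by blast
  then show ?thesis using fin by (meson finite_imageI finite_subset)
qed

lemma r_coset_eq_imp:
  assumes H: "subgroup H G" and "x \<in> carrier G" "y \<in> carrier G" "H #> x = H #> y"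
  shows "x \<otimes> inv y \<in> H"
  using assms coset_mult_inv2[OF assms(4,2,3) subgroup.subset[OF H]]
  by (intro coset_join1[OF _ _ H]) auto

text \<open>\<open>K\<close> is the kernel of the action on the right cosets by right
  multiplication. It fixes the coset \<open>H\<close>, hence lies in \<open>H\<close>, and its index
  is bounded by the number of self-maps of a finite set.\<close>

lemma finite_index_core:
  assumes H: "subgroup H G" and fin: "finite (rcosets H)"
  shows "\<exists>K. K \<lhd> G \<and> K \<subseteq> H \<and> finite (rcosets K)"
proof -
  define K where "K = {x \<in> carrier G. \<forall>C\<in>rcosets H. C #> x = C}"
  have sub: "C \<subseteq> carrier G" if "C \<in> rcosets H" for C
    using that subgroup.rcosets_carrier[OF H] is_group by blast
  have act: "C #> x \<in> rcosets H" if "C \<in> rcosets H" "x \<in> carrier G" for C x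
    using that subgroup.subset[OF H] unfolding rcosets_eq_image
    by (auto simp: coset_mult_assoc)
  have Kinv: "C #> inv x = C" if "x \<in> K" "C \<in> rcosets H" for C x
  proof -
    have "x \<in> carrier G" "C #> x = C" using that by (simp_all add: K_def)
    with coset_mult_assoc[OF sub[OF that(2)], of x "inv x"] sub[OF that(2)] show ?thesis by simp
  qed
  have K: "subgroup K G"
  proof (rule subgroupI)
    have "\<one> \<in> K" using sub by (simp add: K_def)
    then show "K \<noteq> {}" by blast
  next
    fix x assume "x \<in> K"
    then show "inv x \<in> K" using Kinv by (simp add: K_def)
  next
    fix x y assume "x \<in> K" "y \<in> K"
    then show "x \<otimes> y \<in> K" using sub by (simp add: K_def flip: coset_mult_assoc)
  qed (simp add: K_def subset_iff)
  have "K \<lhd> G"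
  proof (rule normal_invI[OF K])
    fix x k assume x: "x \<in> carrier G" and k: "k \<in> K"
    then have kc: "k \<in> carrier G" by (simp add: K_def)
    have "C #> (x \<otimes> k \<otimes> inv x) = C" if C: "C \<in> rcosets H" for C
    proof -
      have "C #> (x \<otimes> k \<otimes> inv x) = ((C #> x) #> k) #> inv x"
        using x kc sub[OF C] r_coset_subset_G by (simp add: coset_mult_assoc m_assoc)
      also have "(C #> x) #> k = C #> x" using k act[OF C x] by (simp add: K_def)
      also have "(C #> x) #> inv x = C" using x sub[OF C] by (simp add: coset_mult_assoc)
      finally show ?thesis .
    qed
    then show "x \<otimes> k \<otimes> inv x \<in> K" using x kc by (simp add: K_def)
  qed
  moreover have "K \<subseteq> H"
  proof
    fix x assume "x \<in> K"
    moreover have "H \<in> rcosets H" by (rule subgroup.subgroup_in_rcosets[OF H is_group])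
    ultimately show "x \<in> H" by (intro coset_join1[OF _ _ H]) (auto simp: K_def)
  qed
  moreover have "finite (rcosets K)"
  proof (rule finite_rcosetsI[OF K])
    let ?c = "\<lambda>x. \<lambda>C\<in>rcosets H. C #> x"
    have "?c ` carrier G \<subseteq> (\<Pi>\<^sub>E C\<in>rcosets H. rcosets H)" using act by auto
    then show "finite (?c ` carrier G)"
      using fin by (meson finite_PiE finite_subset)
    fix x y assume xy: "x \<in> carrier G" "y \<in> carrier G" "?c x = ?c y"
    have "C #> (x \<otimes> inv y) = C" if C: "C \<in> rcosets H" for C
      using fun_cong[OF xy(3), of C] C xy(1,2) sub by (intro coset_mult_inv2) auto
    then show "x \<otimes> inv y \<in> K" using xy by (simp add: K_def)
  qed
  ultimately show ?thesis by blast
qed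

text \<open>Schreier's lemma: with \<open>f\<close> picking coset representatives, the elements
  \<open>t s (f (t s))\<^sup>-\<^sup>1\<close> generate the subgroup.\<close>

lemma finitely_generated_finite_index:
  assumes fg: "finitely_generated G" and H: "subgroup H G" and fin: "finite (rcosets H)"
  shows "finitely_generated (G\<lparr>carrier := H\<rparr>)"
proof -
  obtain S where S: "finite S" "S \<subseteq> carrier G" "generate G S = carrier G"
    using fg by (auto simp: finitely_generated_def)
  interpret H: subgroup H G by (rule H)
  \<comment> \<open>The coset \<open>H\<close> is represented by \<open>\<one>\<close>, so
    \<open>f\<close> is \<open>\<one>\<close> on \<open>H\<close>, and rewriting an element of
    \<open>H\<close> from the start \<open>\<one>\<close> returns that element itself.\<close>
  define r where "r C = (if C = H then \<one> else SOME z. z \<in> C)" for C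
  define f where "f x = r (H #> x)" for x
  have f_mem: "f x \<in> H #> x" if x: "x \<in> carrier G" for x
  proof (cases "H #> x = H")
    case True
    then show ?thesis by (simp add: f_def r_def)
  next
    case False
    have "x \<in> H #> x" by (rule rcos_self[OF x H])
    then have "(SOME z. z \<in> H #> x) \<in> H #> x" by (rule someI)
    then show ?thesis unfolding f_def r_def using False by simp
  qed
  have coset_f: "H #> f x = H #> x" if "x \<in> carrier G" for x
    using repr_independence[OF f_mem[OF that] that H] by simp
  have f_car: "f x \<in> carrier G" if "x \<in> carrier G" for x
    using f_mem[OF that] that r_coset_subset_G[OF H.subset] by blast
  have f_cong: "f x = f y" if "H #> x = H #> y" for x y
    using that by (simp add: f_def)
  have f_mult: "f (f x \<otimes> y) = f (x \<otimes> y)" if "x \<in> carrier G" "y \<in> carrier G" for x y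
    by (rule f_cong) (use that f_car coset_f coset_mult_assoc[OF H.subset] in metis)
  have f_H: "f h = \<one>" if "h \<in> H" for h
    using coset_join2[OF _ H that] that by (simp add: f_def r_def)
  define u where "u = (\<lambda>(t, s). t \<otimes> s \<otimes> inv (f (t \<otimes> s)))"
  define U where "U = u ` (f ` carrier G \<times> S)"
  have U_I: "f y \<otimes> s \<otimes> inv (f (f y \<otimes> s)) \<in> U" if "y \<in> carrier G" "s \<in> S" for y s
    unfolding U_def using that by (intro image_eqI[of _ _ "(f y, s)"]) (simp_all add: u_def)
  have "f ` carrier G = r ` (rcosets H)"
    unfolding f_def rcosets_eq_image by (simp add: image_image)
  then have "finite U" unfolding U_def using fin S(1) by simp
  have quot: "z \<otimes> inv (f z) \<in> H" if "z \<in> carrier G" for z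
    by (rule r_coset_eq_imp[OF H]) (use that f_car coset_f in auto)
  have U_H: "U \<subseteq> H"
  proof
    fix v assume "v \<in> U"
    then obtain y s where ys: "y \<in> carrier G" "s \<in> S" and v: "v = u (f y, s)"
      unfolding U_def by (elim imageE SigmaE) simp
    have "f y \<otimes> s \<in> carrier G" using f_car[OF ys(1)] ys(2) S(2) by blast
    then have "(f y \<otimes> s) \<otimes> inv (f (f y \<otimes> s)) \<in> H" by (rule quot)
    then show "v \<in> H" unfolding v u_def by simp
  qed
  \<comment> \<open>The start \<open>y\<close> is arbitrary, so in a product the second factor can
    be rewritten from where the first one ended; the intermediate representatives cancel.\<close>
  have "f y \<otimes> x \<otimes> inv (f (y \<otimes> x)) \<in> generate G U"
    if "x \<in> generate G S" "y \<in> carrier G" for x y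
    using that
  proof (induction arbitrary: y)
    case one
    then show ?case using f_car by (simp add: generate.one)
  next
    case (incl s)
    then have "f y \<otimes> s \<otimes> inv (f (f y \<otimes> s)) \<in> U" by (intro U_I)
    also have "f (f y \<otimes> s) = f (y \<otimes> s)" using incl S(2) by (intro f_mult) auto
    finally show ?case by (rule generate.incl)
  next
    case (inv s)
    then have s: "s \<in> carrier G" using S(2) by blast
    define z where "z = y \<otimes> inv s"
    have z: "z \<in> carrier G" "z \<otimes> s = y" using s inv by (auto simp: z_def m_assoc)
    have "f z \<otimes> s \<otimes> inv (f (f z \<otimes> s)) \<in> U" by (rule U_I[OF z(1) inv(1)])
    then have "f z \<otimes> s \<otimes> inv (f y) \<in> U" using f_mult[OF z(1) s] z(2) by simp
    then have "inv (f z \<otimes> s \<otimes> inv (f y)) \<in> generate G U" by (rule generate.inv)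
    also have "inv (f z \<otimes> s \<otimes> inv (f y)) = f y \<otimes> inv s \<otimes> inv (f z)"
      using s f_car z inv by (simp add: inv_mult_group m_assoc)
    finally show ?case by (simp add: z_def)
  next
    case (eng u v)
    then have uv: "u \<in> carrier G" "v \<in> carrier G" using S(3) by auto
    have "(f y \<otimes> u \<otimes> inv (f (y \<otimes> u))) \<otimes> (f (y \<otimes> u) \<otimes> v \<otimes> inv (f ((y \<otimes> u) \<otimes> v))) \<in> generate G U"
      by (rule generate.eng[OF eng.IH(1)[OF eng.prems] eng.IH(2)]) (use eng.prems uv in auto)
    also have "(f y \<otimes> u \<otimes> inv (f (y \<otimes> u))) \<otimes> (f (y \<otimes> u) \<otimes> v \<otimes> inv (f ((y \<otimes> u) \<otimes> v))) =
        f y \<otimes> (u \<otimes> v) \<otimes> inv (f (y \<otimes> (u \<otimes> v)))"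
      using eng.prems uv f_car by (simp add: m_assoc)
    finally show ?case .
  qed
  note gen = this
  have "H \<subseteq> generate G U"
  proof
    fix x assume x: "x \<in> H"
    then show "x \<in> generate G U"
      using gen[of x \<one>] S(3) f_H[OF x] f_H[OF H.one_closed] by simp
  qed
  then have "generate G U = H"
    using generate_subgroup_incl[OF U_H H] by blast
  then have "generate (G\<lparr>carrier := H\<rparr>) U = H"
    using generate_consistent[OF U_H H] by simp
  with \<open>finite U\<close> U_H show ?thesis
    unfolding finitely_generated_def by (intro exI[of _ U]) simp
qed

lemma lower_central_subset: "lower_central G n \<subseteq> carrier G"
proof (induction n)
  case (Suc n)
  then have "{commutator G x y |x y. x \<in> lower_central G n \<and> y \<in> carrier G} \<subseteq> carrier G" by auto
  then show ?case unfolding lower_central.simps by (rule generate_incl)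
qed simp

end

section \<open>Finite index, generation and nilpotency under homomorphisms\<close>

context group_hom
begin

lemma finite_rcosets_vimage:
  assumes K: "subgroup K H" and fin: "finite (rcosets\<^bsub>H\<^esub> K)"
  shows "subgroup {x \<in> carrier G. h x \<in> K} G" "finite (rcosets {x \<in> carrier G. h x \<in> K})"
proof -
  interpret K: subgroup K H by (rule K)
  show sg: "subgroup {x \<in> carrier G. h x \<in> K} G"
  proof (rule G.subgroupI)
    have "\<one> \<in> {x \<in> carrier G. h x \<in> K}" by simp
    then show "{x \<in> carrier G. h x \<in> K} \<noteq> {}" by blast
  qed auto
  show "finite (rcosets {x \<in> carrier G. h x \<in> K})"
  proof (rule G.finite_rcosetsI[OF sg])
    have "(\<lambda>x. K #>\<^bsub>H\<^esub> h x) ` carrier G \<subseteq> rcosets\<^bsub>H\<^esub> K"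
      unfolding H.rcosets_eq_image by auto
    then show "finite ((\<lambda>x. K #>\<^bsub>H\<^esub> h x) ` carrier G)" using fin finite_subset by blast
    fix x y assume "x \<in> carrier G" "y \<in> carrier G" "K #>\<^bsub>H\<^esub> h x = K #>\<^bsub>H\<^esub> h y"
    then show "x \<otimes> inv y \<in> {x \<in> carrier G. h x \<in> K}"
      using H.r_coset_eq_imp[OF K, of "h x" "h y"] by simp
  qed
qed

lemma finitely_generated_image:
  assumes "finitely_generated G" "h ` carrier G = carrier H"
  shows "finitely_generated H"
proof -
  obtain S where S: "finite S" "S \<subseteq> carrier G" "generate G S = carrier G"
    using assms(1) by (auto simp: finitely_generated_def)
  then show ?thesis
    unfolding finitely_generated_def using assms(2) generate_img[OF S(2)]
    by (intro exI[of _ "h ` S"]) auto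
qed

text \<open>\<open>K\<close> is the core of the preimage of a nilpotent subgroup of finite index.
  Pulling back the lower central series of that subgroup bounds the action of
  \<open>K\<close>.\<close>

lemma virtually_nilpotent_image:
  assumes vn: "virtually_nilpotent H"
    and ker: "\<And>x. x \<in> carrier G \<Longrightarrow> h x = \<one>\<^bsub>H\<^esub> \<Longrightarrow> x \<in> N"
  shows "\<exists>K c. K \<lhd> G \<and> finite (rcosets K) \<and> carrier G \<subseteq> (centralizer_mod G K ^^ c) N"
proof -
  obtain M n where M: "subgroup M H" "finite (rcosets\<^bsub>H\<^esub> M)"
    and n: "lower_central (H\<lparr>carrier := M\<rparr>) n = {\<one>\<^bsub>H\<^esub>}"
    using vn unfolding virtually_nilpotent_def nilpotent_group_def by auto
  interpret M: group "H\<lparr>carrier := M\<rparr>" by (rule H.subgroup_imp_group[OF M(1)])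
  obtain K where K: "K \<lhd> G" "K \<subseteq> {x \<in> carrier G. h x \<in> M}" "finite (rcosets K)"
    using G.finite_index_core[OF finite_rcosets_vimage[OF M]] by blast
  let ?Z = "\<lambda>i. (centralizer_mod G K ^^ i) N"
  \<comment> \<open>The lower central series descends while the stages ascend, hence
    \<open>n - i\<close>; at \<open>i = 0\<close> the trivial term pulls back into
    \<open>N\<close>.\<close>
  have step: "{x \<in> carrier G. h x \<in> lower_central (H\<lparr>carrier := M\<rparr>) (n - i)} \<subseteq> ?Z i" if "i \<le> n" for i
    using that
  proof (induction i)
    case 0
    then show ?case using n ker by auto
  next
    case (Suc i)
    show ?case
    proof
      fix x assume x: "x \<in> {x \<in> carrier G. h x \<in> lower_central (H\<lparr>carrier := M\<rparr>) (n - Suc i)}"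
      then have xM: "h x \<in> M" using M.lower_central_subset by auto
      have "x \<in> centralizer_mod G K (?Z i)"
      proof (rule centralizer_modI)
        fix k assume "k \<in> K"
        then have k: "k \<in> carrier G" "h k \<in> M" using K(2) by auto
        have "commutator (H\<lparr>carrier := M\<rparr>) (h x) (h k) \<in> lower_central (H\<lparr>carrier := M\<rparr>) (Suc (n - Suc i))"
          unfolding lower_central.simps using x k(2) by (intro generate.incl) auto
        moreover have "commutator (H\<lparr>carrier := M\<rparr>) (h x) (h k) = h (commutator G x k)"
          using x k xM M(1) by (simp add: commutator_def H.m_inv_consistent)
        moreover have "Suc (n - Suc i) = n - i" using Suc.prems by simp
        ultimately have "h (commutator G x k) \<in> lower_central (H\<lparr>carrier := M\<rparr>) (n - i)"
          by simp
        then show "commutator G x k \<in> ?Z i"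
          using Suc.IH Suc.prems x k by auto
      qed (use x in auto)
      then show "x \<in> ?Z (Suc i)" by simp
    qed
  qed
  have "K \<subseteq> ?Z n" using step[of n] K(2) by auto
  \<comment> \<open>Commutators with the normal subgroup \<open>K\<close> fall into
    \<open>K\<close>, so one more stage covers the whole group.\<close>
  then have "carrier G \<subseteq> ?Z (Suc n)"
    using G.commutator_mem_normal_right[OF K(1)] by (auto intro!: centralizer_modI)
  with K(1,3) show ?thesis by blast
qed

end

section \<open>Homomorphisms out of the weak commutativity group\<close>

text \<open>Evaluating a word letter by letter respects the defining congruence, so any
  representative of a class gives the same value.\<close>

lemma free_product_universal:
  assumes groups: "group G\<^sub>1" "group G\<^sub>2" "group H"
    and f1: "f\<^sub>1 \<in> hom G\<^sub>1 H" and f2: "f\<^sub>2 \<in> hom G\<^sub>2 H"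
  shows "\<exists>F \<in> hom (free_product G\<^sub>1 G\<^sub>2) H.
    (\<forall>g\<in>carrier G\<^sub>1. F (word_class G\<^sub>1 G\<^sub>2 [Inl g]) = f\<^sub>1 g) \<and>
    (\<forall>g\<in>carrier G\<^sub>2. F (word_class G\<^sub>1 G\<^sub>2 [Inr g]) = f\<^sub>2 g)"
proof -
  interpret f1: group_hom G\<^sub>1 H f\<^sub>1 using groups f1 by (simp add: group_hom_def group_hom_axioms_def)
  interpret f2: group_hom G\<^sub>2 H f\<^sub>2 using groups f2 by (simp add: group_hom_def group_hom_axioms_def)
  let ?A = "carrier G\<^sub>1 <+> carrier G\<^sub>2"
  define ev where "ev w = foldr (\<lambda>z. (\<otimes>\<^bsub>H\<^esub>) (case_sum f\<^sub>1 f\<^sub>2 z)) w \<one>\<^bsub>H\<^esub>" for w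
  have letter: "case_sum f\<^sub>1 f\<^sub>2 z \<in> carrier H" if "z \<in> ?A" for z
    using that by auto
  have ev_closed: "ev w \<in> carrier H" if "w \<in> lists ?A" for w
    using that by induction (simp_all add: ev_def letter)
  have ev_append: "ev (u @ v) = ev u \<otimes>\<^bsub>H\<^esub> ev v" if "u \<in> lists ?A" "v \<in> lists ?A" for u v
    using that(1)
  proof induction
    case Nil
    then show ?case using ev_closed[OF that(2)] by (simp add: ev_def)
  next
    case (Cons z u)
    have "ev (z # w) = case_sum f\<^sub>1 f\<^sub>2 z \<otimes>\<^bsub>H\<^esub> ev w" for w by (simp add: ev_def)
    then show ?case
      using Cons letter ev_closed[OF Cons(2)] ev_closed[OF that(2)] by (simp add: f1.H.m_assoc)
  qed
  have ev_cong: "ev u = ev v" if "free_product_eq G\<^sub>1 G\<^sub>2 u v" for u v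
    using that
  proof induction
    case (append u u' v v')
    then show ?case
      using free_product_eq_words[OF groups(1,2)] by (simp add: ev_append)
  qed (simp_all add: ev_def)
  define F where "F A = ev (SOME u. u \<in> A)" for A
  have F: "F (word_class G\<^sub>1 G\<^sub>2 u) = ev u" if "u \<in> lists ?A" for u
  proof -
    have "u \<in> word_class G\<^sub>1 G\<^sub>2 u" using that by (simp add: word_class_def free_product_eq.refl)
    then have "(SOME v. v \<in> word_class G\<^sub>1 G\<^sub>2 u) \<in> word_class G\<^sub>1 G\<^sub>2 u" by (rule someI)
    then have "free_product_eq G\<^sub>1 G\<^sub>2 u (SOME v. v \<in> word_class G\<^sub>1 G\<^sub>2 u)"
      unfolding word_class_def by (rule CollectD)
    then show ?thesis unfolding F_def by (rule ev_cong[symmetric])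
  qed
  have car: "carrier (free_product G\<^sub>1 G\<^sub>2) = word_class G\<^sub>1 G\<^sub>2 ` lists ?A"
    by (simp add: free_product_def)
  have "F \<in> hom (free_product G\<^sub>1 G\<^sub>2) H"
  proof (rule homI)
    fix x assume "x \<in> carrier (free_product G\<^sub>1 G\<^sub>2)"
    then obtain u where "u \<in> lists ?A" "x = word_class G\<^sub>1 G\<^sub>2 u" unfolding car by blast
    then show "F x \<in> carrier H" using F ev_closed by metis
  next
    fix x y assume "x \<in> carrier (free_product G\<^sub>1 G\<^sub>2)" "y \<in> carrier (free_product G\<^sub>1 G\<^sub>2)"
    then obtain u v where uv: "u \<in> lists ?A" "v \<in> lists ?A"
      and xy: "x = word_class G\<^sub>1 G\<^sub>2 u" "y = word_class G\<^sub>1 G\<^sub>2 v"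
      unfolding car by blast
    have "u @ v \<in> lists ?A" using uv by (simp only: append_in_lists_conv)
    with uv show "F (x \<otimes>\<^bsub>free_product G\<^sub>1 G\<^sub>2\<^esub> y) = F x \<otimes>\<^bsub>H\<^esub> F y"
      unfolding xy free_product_mult[OF uv] by (simp only: F ev_append)
  qed
  moreover have "F (word_class G\<^sub>1 G\<^sub>2 [Inl g]) = f\<^sub>1 g" if "g \<in> carrier G\<^sub>1" for g
    using that by (subst F) (auto simp: ev_def)
  moreover have "F (word_class G\<^sub>1 G\<^sub>2 [Inr g]) = f\<^sub>2 g" if "g \<in> carrier G\<^sub>2" for g
    using that by (subst F) (auto simp: ev_def)
  ultimately show ?thesis by blast
qed

section \<open>The two copies of \<open>G\<close> in \<open>\<XX> G\<close> and the three
  projections\<close>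

context
  fixes G :: "('a, 'm) monoid_scheme"
  assumes G: "group G"
begin

private abbreviation FP where "FP \<equiv> free_product G G"
private abbreviation R where
  "R \<equiv> {commutator FP (word_class G G [Inl g]) (word_class G G [Inr g]) | g. g \<in> carrier G}"
private abbreviation N where "N \<equiv> normal_closure FP R"

definition left_copy where "left_copy g = N #>\<^bsub>FP\<^esub> word_class G G [Inl g]"
definition right_copy where "right_copy g = N #>\<^bsub>FP\<^esub> word_class G G [Inr g]"

lemma FP_group: "group FP"
  by (rule free_product_group[OF G G])

lemma letters_in_FP: "g \<in> carrier G \<Longrightarrow> word_class G G [Inl g] \<in> carrier FP"
  "g \<in> carrier G \<Longrightarrow> word_class G G [Inr g] \<in> carrier FP"
  by (auto simp: free_product_def intro!: imageI)

lemma relators_in_FP: "R \<subseteq> carrier FP"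
  using letters_in_FP group.commutator_closed[OF FP_group] by blast

lemma N_normal: "N \<lhd> FP"
  by (rule normal_normal_closure[OF FP_group relators_in_FP])

lemma coset_hom: "(\<lambda>x. N #>\<^bsub>FP\<^esub> x) \<in> hom FP (\<XX> G)"
  unfolding weak_commutativity_group_def by (rule normal.r_coset_hom_Mod[OF N_normal])

lemma letter_hom: "(\<lambda>g. word_class G G [Inl g]) \<in> hom G FP" "(\<lambda>g. word_class G G [Inr g]) \<in> hom G FP"
proof -
  show "(\<lambda>g. word_class G G [Inl g]) \<in> hom G FP"
  proof (rule homI)
    fix g h assume gh: "g \<in> carrier G" "h \<in> carrier G"
    then have "word_class G G [Inl g, Inl h] = word_class G G [Inl (g \<otimes>\<^bsub>G\<^esub> h)]"
      by (subst word_class_eq_iff) (auto intro: free_product_eq.mult_left)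
    then show "word_class G G [Inl (g \<otimes>\<^bsub>G\<^esub> h)] =
        word_class G G [Inl g] \<otimes>\<^bsub>FP\<^esub> word_class G G [Inl h]"
      using gh by (subst free_product_mult) auto
  qed (rule letters_in_FP)
  show "(\<lambda>g. word_class G G [Inr g]) \<in> hom G FP"
  proof (rule homI)
    fix g h assume gh: "g \<in> carrier G" "h \<in> carrier G"
    then have "word_class G G [Inr g, Inr h] = word_class G G [Inr (g \<otimes>\<^bsub>G\<^esub> h)]"
      by (subst word_class_eq_iff) (auto intro: free_product_eq.mult_right)
    then show "word_class G G [Inr (g \<otimes>\<^bsub>G\<^esub> h)] =
        word_class G G [Inr g] \<otimes>\<^bsub>FP\<^esub> word_class G G [Inr h]"
      using gh by (subst free_product_mult) auto
  qed (rule letters_in_FP)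
qed

lemma left_copy_hom: "left_copy \<in> hom G (\<XX> G)" and right_copy_hom: "right_copy \<in> hom G (\<XX> G)"
  using hom_compose[OF letter_hom(1) coset_hom] hom_compose[OF letter_hom(2) coset_hom]
  by (simp_all add: left_copy_def[abs_def] right_copy_def[abs_def] comp_def)

lemma copies_commute:
  assumes g: "g \<in> carrier G"
  shows "left_copy g \<otimes>\<^bsub>\<XX> G\<^esub> right_copy g = right_copy g \<otimes>\<^bsub>\<XX> G\<^esub> left_copy g"
proof -
  interpret FP: group FP by (rule FP_group)
  interpret N: normal N FP by (rule N_normal)
  interpret X: group "\<XX> G" by (rule weak_commutativity_group_group[OF G])
  interpret q: group_hom FP "\<XX> G" "\<lambda>x. N #>\<^bsub>FP\<^esub> x" by unfold_locales (rule coset_hom)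
  let ?x = "word_class G G [Inl g]" and ?y = "word_class G G [Inr g]"
  have "R \<subseteq> N" unfolding normal_closure_def by blast
  then have "commutator FP ?x ?y \<in> N" using g by blast
  then have "N #>\<^bsub>FP\<^esub> commutator FP ?x ?y = \<one>\<^bsub>\<XX> G\<^esub>"
    using FP.coset_join2[OF _ N.subgroup_axioms] letters_in_FP[OF g] FP.commutator_closed
    by (simp add: weak_commutativity_group_def)
  then have "commutator (\<XX> G) (left_copy g) (right_copy g) = \<one>\<^bsub>\<XX> G\<^esub>"
    using q.hom_commutator[OF letters_in_FP[OF g]] by (simp add: left_copy_def right_copy_def)
  then show ?thesis
    using left_copy_hom right_copy_hom g by (subst (asm) X.commutator_eq_one_iff) (auto simp: hom_def)
qed

lemma copies_generate:
  "generate (\<XX> G) (left_copy ` carrier G \<union> right_copy ` carrier G) = carrier (\<XX> G)"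
proof
  interpret FP: group FP by (rule FP_group)
  interpret X: group "\<XX> G" by (rule weak_commutativity_group_group[OF G])
  interpret q: group_hom FP "\<XX> G" "\<lambda>x. N #>\<^bsub>FP\<^esub> x" by unfold_locales (rule coset_hom)
  let ?S = "left_copy ` carrier G \<union> right_copy ` carrier G"
  have S: "?S \<subseteq> carrier (\<XX> G)" using left_copy_hom right_copy_hom by (auto simp: hom_def)
  then show "generate (\<XX> G) ?S \<subseteq> carrier (\<XX> G)" by (rule X.generate_incl)
  have word: "N #>\<^bsub>FP\<^esub> word_class G G w \<in> generate (\<XX> G) ?S"
    if "w \<in> lists (carrier G <+> carrier G)" for w
    using that
  proof induction
    case Nil
    have empty: "word_class G G [] = \<one>\<^bsub>FP\<^esub>" by (simp add: free_product_def)
    show ?case unfolding empty q.hom_one by (rule generate.one)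
  next
    case (Cons z w)
    then have zw: "[z] \<in> lists (carrier G <+> carrier G)" "w \<in> lists (carrier G <+> carrier G)" by auto
    have car: "word_class G G [z] \<in> carrier FP" "word_class G G w \<in> carrier FP"
      using zw by (simp_all add: free_product_def)
    have "N #>\<^bsub>FP\<^esub> word_class G G (z # w) =
        (N #>\<^bsub>FP\<^esub> word_class G G [z]) \<otimes>\<^bsub>\<XX> G\<^esub> (N #>\<^bsub>FP\<^esub> word_class G G w)"
      using q.hom_mult[OF car] free_product_mult[OF zw] by simp
    moreover have "N #>\<^bsub>FP\<^esub> word_class G G [z] \<in> ?S"
      using zw(1) by (auto simp: left_copy_def right_copy_def)
    ultimately show ?case using Cons.IH by (simp add: generate.eng generate.incl)
  qed
  show "carrier (\<XX> G) \<subseteq> generate (\<XX> G) ?S"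
  proof
    fix x assume "x \<in> carrier (\<XX> G)"
    then obtain y where y: "y \<in> carrier FP" "x = N #>\<^bsub>FP\<^esub> y"
      by (auto simp: weak_commutativity_group_def carrier_FactGroup)
    then obtain w where "w \<in> lists (carrier G <+> carrier G)" "y = word_class G G w"
      unfolding free_product_def by auto
    with word y(2) show "x \<in> generate (\<XX> G) ?S" by simp
  qed
qed

text \<open>The map on the free product kills the relators, hence their normal closure, and so
  factors through the quotient.\<close>

lemma weak_commutativity_universal:
  assumes H: "group H" and f1: "f\<^sub>1 \<in> hom G H" and f2: "f\<^sub>2 \<in> hom G H"
    and comm: "\<And>g. g \<in> carrier G \<Longrightarrow> f\<^sub>1 g \<otimes>\<^bsub>H\<^esub> f\<^sub>2 g = f\<^sub>2 g \<otimes>\<^bsub>H\<^esub> f\<^sub>1 g"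
  shows "\<exists>F \<in> hom (\<XX> G) H. (\<forall>g\<in>carrier G. F (left_copy g) = f\<^sub>1 g \<and> F (right_copy g) = f\<^sub>2 g)"
proof -
  interpret H: group H by (rule H)
  obtain F where F: "F \<in> hom FP H" "\<And>g. g \<in> carrier G \<Longrightarrow> F (word_class G G [Inl g]) = f\<^sub>1 g"
    "\<And>g. g \<in> carrier G \<Longrightarrow> F (word_class G G [Inr g]) = f\<^sub>2 g"
    using free_product_universal[OF G G H f1 f2] by blast
  interpret F: group_hom FP H F
    using FP_group H F(1) by (simp add: group_hom_def group_hom_axioms_def)
  have "F (commutator FP (word_class G G [Inl g]) (word_class G G [Inr g])) = \<one>\<^bsub>H\<^esub>"
    if g: "g \<in> carrier G" for g
    using F.hom_commutator[OF letters_in_FP[OF g]] F(2,3)[OF g] comm[OF g] g f1 f2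
      H.commutator_eq_one_iff[of "f\<^sub>1 g" "f\<^sub>2 g"]
    by (auto simp: hom_def)
  then have "R \<subseteq> kernel FP H F"
    using relators_in_FP unfolding kernel_def by blast
  then have "N \<subseteq> kernel FP H F"
    unfolding normal_closure_def using F.normal_kernel by blast
  then obtain F' where "F' \<in> hom (\<XX> G) H" "\<And>x. x \<in> carrier FP \<Longrightarrow> F' (N #>\<^bsub>FP\<^esub> x) = F x"
    using F.FactGroup_universal_kernel[OF N_normal] unfolding weak_commutativity_group_def by blast
  with F letters_in_FP show ?thesis
    by (intro bexI[of _ F']) (auto simp: left_copy_def right_copy_def)
qed

text \<open>The projections come from the pairs identity and trivial map, trivial map and identity,
  and identity twice; the values of each pair at any \<open>g\<close> commute.\<close>

lemma weak_commutativity_XX: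
  "\<exists>p\<^sub>1 p\<^sub>2 p\<^sub>3. weak_commutativity (\<XX> G) G left_copy right_copy p\<^sub>1 p\<^sub>2 p\<^sub>3"
proof -
  interpret G: group G by (rule G)
  have id: "id \<in> hom G G" and one: "(\<lambda>_. \<one>\<^bsub>G\<^esub>) \<in> hom G G" by (auto simp: hom_def)
  obtain p\<^sub>1 where "p\<^sub>1 \<in> hom (\<XX> G) G"
    "\<forall>g\<in>carrier G. p\<^sub>1 (left_copy g) = id g \<and> p\<^sub>1 (right_copy g) = \<one>\<^bsub>G\<^esub>"
    using weak_commutativity_universal[OF G id one] by auto
  moreover obtain p\<^sub>2 where "p\<^sub>2 \<in> hom (\<XX> G) G"
    "\<forall>g\<in>carrier G. p\<^sub>2 (left_copy g) = \<one>\<^bsub>G\<^esub> \<and> p\<^sub>2 (right_copy g) = id g"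
    using weak_commutativity_universal[OF G one id] by auto
  moreover obtain p\<^sub>3 where "p\<^sub>3 \<in> hom (\<XX> G) G"
    "\<forall>g\<in>carrier G. p\<^sub>3 (left_copy g) = id g \<and> p\<^sub>3 (right_copy g) = id g"
    using weak_commutativity_universal[OF G id id] by auto
  ultimately have "weak_commutativity (\<XX> G) G left_copy right_copy p\<^sub>1 p\<^sub>2 p\<^sub>3"
    using G weak_commutativity_group_group[OF G] left_copy_hom right_copy_hom copies_generate
      copies_commute
    by (simp add: weak_commutativity_def weak_commutativity_axioms_def)
  then show ?thesis by blast
qed

end

section \<open>Closure properties of classes of groups\<close>

lemma group_homI: "group G \<Longrightarrow> group H \<Longrightarrow> h \<in> hom G H \<Longrightarrow> group_hom G H h"
  by (simp add: group_hom_def group_hom_axioms_def)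

lemma isoD: "f \<in> iso G H \<Longrightarrow> f \<in> hom G H" "f \<in> iso G H \<Longrightarrow> f ` carrier G = carrier H"
  "f \<in> iso G H \<Longrightarrow> inj_on f (carrier G)"
  by (auto simp: iso_def bij_betw_def)

lemma iso_kernel_compose:
  assumes "group H" "group K" "f \<in> hom G H" "\<theta> \<in> iso H K"
  shows "kernel G K (\<theta> \<circ> f) = kernel G H f"
proof -
  interpret \<theta>: group_hom H K \<theta> using assms isoD(1) by (intro group_homI)
  have "\<theta> (f x) = \<one>\<^bsub>K\<^esub> \<longleftrightarrow> f x = \<one>\<^bsub>H\<^esub>" if "x \<in> carrier G" for x
    using inj_onD[OF isoD(3)[OF assms(4)], of "f x" "\<one>\<^bsub>H\<^esub>"] hom_in_carrier[OF assms(3) that] by auto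
  then show ?thesis by (auto simp: kernel_def)
qed

section \<open>Transfer of the closure properties to groups over arbitrary types\<close>

context
  fixes P :: "nat monoid set"
  assumes P: "fg_group_class P"
    and subgroups: "closed_under_fg_subgroups P"
    and quotients: "closed_under_quotients P"
    and central: "closed_under_central_extensions P"
    and finite_ext: "closed_under_finite_extensions P"
    and products: "closed_under_finite_products P"
begin

lemma mem_group: "H \<in> P \<Longrightarrow> group H" and mem_fg: "H \<in> P \<Longrightarrow> finitely_generated H"
  using P by (auto simp: fg_group_class_def)

lemma in_class_cong: "G \<cong> H \<Longrightarrow> in_class H P \<Longrightarrow> in_class G P"
  unfolding in_class_def using iso_trans by blast

lemma in_class_nat:
  assumes "group K" "in_class K P"
  shows "K \<in> P"
proof -
  obtain H where "H \<in> P" "K \<cong> H" using assms(2) unfolding in_class_def by blast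
  then show ?thesis using P assms(1) group.iso_sym unfolding fg_group_class_def by blast
qed

lemma in_classE:
  assumes "in_class G P"
  obtains H \<theta> where "H \<in> P" "group H" "\<theta> \<in> iso G H"
  using assms mem_group unfolding in_class_def is_iso_def by blast

lemma in_class_fg:
  assumes "group G" "in_class G P"
  shows "finitely_generated G"
proof -
  obtain H \<theta> where H: "H \<in> P" "group H" "\<theta> \<in> iso G H" using in_classE[OF assms(2)] .
  have "inv_into (carrier G) \<theta> \<in> iso H G" by (rule group.iso_set_sym[OF assms(1) H(3)])
  then show ?thesis
    using group_hom.finitely_generated_image[OF group_homI[OF H(2) assms(1)] mem_fg[OF H(1)]] isoD
    by metis
qed

lemma in_class_surj:
  assumes G: "group G" "in_class G P" and H: "group H" and f: "f \<in> hom G H" "f ` carrier G = carrier H"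
  shows "in_class H P"
proof -
  obtain G0 \<theta> where G0: "G0 \<in> P" "group G0" "\<theta> \<in> iso G G0" using in_classE[OF G(2)] .
  define \<psi> where "\<psi> = inv_into (carrier G) \<theta>"
  have \<psi>: "\<psi> \<in> iso G0 G" unfolding \<psi>_def by (rule group.iso_set_sym[OF G(1) G0(3)])
  have "f \<circ> \<psi> \<in> hom G0 H" using hom_compose[OF isoD(1)[OF \<psi>] f(1)] .
  then interpret g: group_hom G0 H "f \<circ> \<psi>" by (intro group_homI G0 H)
  have "(f \<circ> \<psi>) ` carrier G0 = carrier H"
    using isoD(2)[OF \<psi>] f(2) by (metis image_comp)
  then have "G0 Mod kernel G0 H (f \<circ> \<psi>) \<cong> H" by (rule g.FactGroup_iso)
  then have "H \<cong> G0 Mod kernel G0 H (f \<circ> \<psi>)"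
    by (rule group.iso_sym[OF normal.factorgroup_is_group[OF g.normal_kernel]])
  moreover have "in_class (G0 Mod kernel G0 H (f \<circ> \<psi>)) P"
    using quotients G0(1) g.normal_kernel unfolding closed_under_quotients_def by blast
  ultimately show ?thesis by (rule in_class_cong)
qed

text \<open>The quotient is isomorphic to the image of \<open>A\<close>, a subgroup that is finitely
  generated because \<open>A\<close> is.\<close>

lemma in_class_fg_image:
  assumes A: "group A" "finitely_generated A" and H: "group H" "in_class H P" and f: "f \<in> hom A H"
  shows "in_class (A Mod kernel A H f) P"
proof -
  obtain H0 \<theta> where H0: "H0 \<in> P" "group H0" "\<theta> \<in> iso H H0" using in_classE[OF H(2)] .
  let ?g = "\<theta> \<circ> f"
  have g: "?g \<in> hom A H0" by (rule hom_compose[OF f isoD(1)[OF H0(3)]])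
  interpret g: group_hom A H0 ?g by (rule group_homI[OF A(1) H0(2) g])
  let ?S = "?g ` carrier A"
  have S: "subgroup ?S H0" by (rule g.img_is_subgroup)
  have "?g \<in> hom A (H0\<lparr>carrier := ?S\<rparr>)" using g by (auto simp: hom_def)
  then interpret g': group_hom A "H0\<lparr>carrier := ?S\<rparr>" ?g
    by (intro group_homI A g.H.subgroup_imp_group[OF S])
  have "finitely_generated (H0\<lparr>carrier := ?S\<rparr>)"
    by (rule g'.finitely_generated_image[OF A(2)]) simp
  then have "H0\<lparr>carrier := ?S\<rparr> \<in> P"
    using subgroups H0(1) S unfolding closed_under_fg_subgroups_def by blast
  moreover have "A Mod kernel A (H0\<lparr>carrier := ?S\<rparr>) ?g \<cong> H0\<lparr>carrier := ?S\<rparr>"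
    by (rule g'.FactGroup_iso) simp
  moreover have "kernel A (H0\<lparr>carrier := ?S\<rparr>) ?g = kernel A H f"
    using iso_kernel_compose[OF H(1) H0(2) f H0(3)] by (simp add: kernel_def)
  ultimately show ?thesis unfolding in_class_def by auto
qed

text \<open>The image of \<open>M\<close> is central in \<open>E / N\<close> by the commutator
  condition, and dividing it out gives \<open>E / M\<close>, so \<open>E / N\<close> is a central
  extension of a member of the class.\<close>

lemma in_class_central_step:
  assumes E: "group E" "finitely_generated E" and N: "N \<lhd> E" "M \<lhd> E" "N \<subseteq> M"
    and comm: "\<And>z y. z \<in> M \<Longrightarrow> y \<in> carrier E \<Longrightarrow> commutator E z y \<in> N"
    and M: "in_class (E Mod M) P"
  shows "in_class (E Mod N) P"
proof -
  interpret E: group E by (rule E)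
  have Q: "group (E Mod N)" by (rule normal.factorgroup_is_group[OF N(1)])
  have q: "(\<lambda>x. N #>\<^bsub>E\<^esub> x) \<in> hom E (E Mod N)" by (rule normal.r_coset_hom_Mod[OF N(1)])
  interpret q: group_hom E "E Mod N" "\<lambda>x. N #>\<^bsub>E\<^esub> x" by (rule group_homI[OF E(1) Q q])
  have q_surj: "(\<lambda>x. N #>\<^bsub>E\<^esub> x) ` carrier E = carrier (E Mod N)"
    by (simp add: carrier_FactGroup)
  have fgQ: "finitely_generated (E Mod N)"
    by (rule q.finitely_generated_image[OF E(2) q_surj])
  have ker_q: "N #>\<^bsub>E\<^esub> x = \<one>\<^bsub>E Mod N\<^esub> \<longleftrightarrow> x \<in> N" if "x \<in> carrier E" for x
    using E.coset_join1[OF _ that normal_imp_subgroup[OF N(1)]]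
      E.coset_join2[OF that normal_imp_subgroup[OF N(1)]] by auto
  \<comment> \<open>Closure under central extensions is stated for groups on the natural numbers, so
    \<open>E / N\<close> is replaced by such a copy.\<close>
  obtain Q0 :: "nat monoid" where Q0: "group Q0" "E Mod N \<cong> Q0"
    using finitely_generated_nat_copy[OF Q fgQ] by blast
  then obtain \<theta> where \<theta>: "\<theta> \<in> iso (E Mod N) Q0" unfolding is_iso_def by blast
  interpret Q0: group Q0 by (rule Q0(1))
  interpret \<theta>: group_hom "E Mod N" Q0 \<theta> by (rule group_homI[OF Q Q0(1) isoD(1)[OF \<theta>]])
  define \<pi> where "\<pi> x = \<theta> (N #>\<^bsub>E\<^esub> x)" for x
  have \<pi>: "\<pi> \<in> hom E Q0"
    using hom_compose[OF q isoD(1)[OF \<theta>]] by (simp add: \<pi>_def[abs_def] comp_def)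
  interpret \<pi>: group_hom E Q0 \<pi> by (rule group_homI[OF E(1) Q0(1) \<pi>])
  have \<pi>_surj: "\<pi> ` carrier E = carrier Q0"
    using isoD(2)[OF \<theta>] q_surj by (auto simp: \<pi>_def[abs_def] simp flip: image_image)
  have "kernel E Q0 \<pi> = kernel E (E Mod N) (\<lambda>x. N #>\<^bsub>E\<^esub> x)"
    using iso_kernel_compose[OF Q Q0(1) q \<theta>] by (simp add: \<pi>_def[abs_def] comp_def)
  then have ker: "\<pi> x = \<one>\<^bsub>Q0\<^esub> \<longleftrightarrow> x \<in> N" if "x \<in> carrier E" for x
    using ker_q[OF that] that by (auto simp: kernel_def)
  have fgQ0: "finitely_generated Q0"
    by (rule \<pi>.finitely_generated_image[OF E(2) \<pi>_surj])
  let ?Z = "\<pi> ` M"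
  have Z: "subgroup ?Z Q0" by (rule \<pi>.subgroup_img_is_subgroup[OF normal_imp_subgroup[OF N(2)]])
  have cent: "z \<otimes>\<^bsub>Q0\<^esub> y = y \<otimes>\<^bsub>Q0\<^esub> z" if z: "z \<in> ?Z" and y: "y \<in> carrier Q0" for z y
  proof -
    obtain u where u: "u \<in> M" "z = \<pi> u" using z by blast
    obtain v where v: "v \<in> carrier E" "y = \<pi> v" using y \<pi>_surj by blast
    have uc: "u \<in> carrier E" by (rule E.normal_subset[OF N(2) u(1)])
    have "\<pi> (commutator E u v) = \<one>\<^bsub>Q0\<^esub>"
      using ker comm[OF u(1) v(1)] uc v(1) by simp
    then show ?thesis
      unfolding u v using \<pi>.hom_commutator[OF uc v(1)] Q0.commutator_eq_one_iff[of "\<pi> u" "\<pi> v"] uc v(1)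
      by simp
  qed
  have Zn: "?Z \<lhd> Q0"
  proof (rule Q0.normal_invI[OF Z])
    fix x z assume x: "x \<in> carrier Q0" and z: "z \<in> ?Z"
    then have zc: "z \<in> carrier Q0" using subgroup.mem_carrier[OF Z] by blast
    have "x \<otimes>\<^bsub>Q0\<^esub> z \<otimes>\<^bsub>Q0\<^esub> inv\<^bsub>Q0\<^esub> x = z"
      unfolding cent[OF z x, symmetric] using x zc by (simp add: Q0.m_assoc)
    then show "x \<otimes>\<^bsub>Q0\<^esub> z \<otimes>\<^bsub>Q0\<^esub> inv\<^bsub>Q0\<^esub> x \<in> ?Z" using z by simp
  qed
  have R: "group (Q0 Mod ?Z)" by (rule normal.factorgroup_is_group[OF Zn])
  define \<rho> where "\<rho> x = ?Z #>\<^bsub>Q0\<^esub> \<pi> x" for x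
  have "\<rho> \<in> hom E (Q0 Mod ?Z)"
    using hom_compose[OF \<pi> normal.r_coset_hom_Mod[OF Zn]] by (simp add: \<rho>_def[abs_def] comp_def)
  then interpret \<rho>: group_hom E "Q0 Mod ?Z" \<rho> by (rule group_homI[OF E(1) R])
  have "\<rho> ` carrier E = (\<lambda>x. ?Z #>\<^bsub>Q0\<^esub> x) ` (\<pi> ` carrier E)"
    unfolding \<rho>_def by (simp add: image_image)
  then have \<rho>_surj: "\<rho> ` carrier E = carrier (Q0 Mod ?Z)"
    unfolding \<pi>_surj by (simp add: carrier_FactGroup)
  \<comment> \<open>The third isomorphism theorem along the copy; \<open>N \<subseteq> M\<close>
    gives the inclusion of the kernel in \<open>M\<close>.\<close>
  have "kernel E (Q0 Mod ?Z) \<rho> = M"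
  proof
    show "M \<subseteq> kernel E (Q0 Mod ?Z) \<rho>"
    proof
      fix x assume x: "x \<in> M"
      then have "x \<in> carrier E" by (rule E.normal_subset[OF N(2)])
      then show "x \<in> kernel E (Q0 Mod ?Z) \<rho>"
        using Q0.coset_join2[OF _ Z, of "\<pi> x"] x by (simp add: kernel_def \<rho>_def)
    qed
    show "kernel E (Q0 Mod ?Z) \<rho> \<subseteq> M"
    proof
      fix x assume "x \<in> kernel E (Q0 Mod ?Z) \<rho>"
      then have x: "x \<in> carrier E" "?Z #>\<^bsub>Q0\<^esub> \<pi> x = ?Z" by (simp_all add: kernel_def \<rho>_def)
      then have "\<pi> x \<in> ?Z" using Q0.coset_join1[OF _ _ Z] by simp
      then obtain u where u: "u \<in> M" "\<pi> x = \<pi> u" by blast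
      have uc: "u \<in> carrier E" by (rule E.normal_subset[OF N(2) u(1)])
      have "\<pi> (x \<otimes>\<^bsub>E\<^esub> inv\<^bsub>E\<^esub> u) = \<one>\<^bsub>Q0\<^esub>" using x uc u(2) by simp
      then have "x \<otimes>\<^bsub>E\<^esub> inv\<^bsub>E\<^esub> u \<in> M" 
        using ker[OF E.m_closed[OF x(1) E.inv_closed[OF uc]]] N(3) by blast
      then have "(x \<otimes>\<^bsub>E\<^esub> inv\<^bsub>E\<^esub> u) \<otimes>\<^bsub>E\<^esub> u \<in> M"
        using u(1) by (rule subgroup.m_closed[OF normal_imp_subgroup[OF N(2)]])
      then show "x \<in> M" using x(1) uc by (simp add: E.m_assoc)
    qed
  qed
  then have "E Mod M \<cong> Q0 Mod ?Z" using \<rho>.FactGroup_iso[OF \<rho>_surj] by simp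
  then have "Q0 Mod ?Z \<cong> E Mod M"
    by (rule group.iso_sym[OF normal.factorgroup_is_group[OF N(2)]])
  then have "in_class (Q0 Mod ?Z) P" using M by (rule in_class_cong)
  moreover have "central_subgroup ?Z Q0" using Z cent by (simp add: central_subgroup_def)
  ultimately have "Q0 \<in> P"
    using central Q0(1) fgQ0 unfolding closed_under_central_extensions_def by blast
  then show ?thesis using Q0(2) unfolding in_class_def by blast
qed

text \<open>Both \<open>E\<close> and the finite quotient are copied to the natural numbers, with
  \<open>N\<close> carried along, to obtain an exact sequence of the required type.\<close>

lemma in_class_finite_extension:
  assumes E: "group E" "finitely_generated E" and N: "N \<lhd> E" "finite (rcosets\<^bsub>E\<^esub> N)"
    and "in_class (E\<lparr>carrier := N\<rparr>) P"
  shows "in_class E P"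
proof -
  interpret E: group E by (rule E)
  obtain E0 :: "nat monoid" where E0: "group E0" "E \<cong> E0"
    using finitely_generated_nat_copy[OF E] by blast
  then obtain \<theta> where \<theta>: "\<theta> \<in> iso E E0" unfolding is_iso_def by blast
  interpret E0: group E0 by (rule E0(1))
  interpret \<theta>: group_hom E E0 \<theta> by (rule group_homI[OF E(1) E0(1) isoD(1)[OF \<theta>]])
  define \<psi> where "\<psi> = inv_into (carrier E) \<theta>"
  have \<psi>: "\<psi> \<in> iso E0 E" unfolding \<psi>_def by (rule E.iso_set_sym[OF \<theta>])
  interpret \<psi>: group_hom E0 E \<psi> by (rule group_homI[OF E0(1) E(1) isoD(1)[OF \<psi>]])
  have \<theta>\<psi>: "\<theta> (\<psi> x) = x" if "x \<in> carrier E0" for x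
    using that isoD(2)[OF \<theta>] by (simp add: \<psi>_def f_inv_into_f)
  have \<psi>\<theta>: "\<psi> (\<theta> x) = x" if "x \<in> carrier E" for x
    using that isoD(3)[OF \<theta>] by (simp add: \<psi>_def)
  define N0 where "N0 = {x \<in> carrier E0. \<psi> x \<in> N}"
  have N0: "N0 \<lhd> E0" unfolding N0_def by (rule \<psi>.normal_vimage[OF N(1)])
  have N0_fin: "finite (rcosets\<^bsub>E0\<^esub> N0)"
    unfolding N0_def by (rule \<psi>.finite_rcosets_vimage(2)[OF normal_imp_subgroup[OF N(1)] N(2)])
  have "\<psi> ` N0 = N"
  proof
    show "N \<subseteq> \<psi> ` N0"
    proof
      fix x assume x: "x \<in> N"
      then have xc: "x \<in> carrier E" by (rule E.normal_subset[OF N(1)])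
      show "x \<in> \<psi> ` N0"
        by (rule image_eqI[of _ _ "\<theta> x"]) (use x xc \<psi>\<theta> in \<open>simp_all add: N0_def\<close>)
    qed
  qed (auto simp: N0_def)
  then have "\<psi> \<in> iso (E0\<lparr>carrier := N0\<rparr>) (E\<lparr>carrier := N\<rparr>)"
    using isoD(3)[OF \<psi>] by (auto simp: iso_def bij_betw_def hom_def N0_def inj_on_def)
  then have "E0\<lparr>carrier := N0\<rparr> \<cong> E\<lparr>carrier := N\<rparr>" unfolding is_iso_def by blast
  then have "in_class (E0\<lparr>carrier := N0\<rparr>) P" using assms(5) by (rule in_class_cong)
  then have N0P: "E0\<lparr>carrier := N0\<rparr> \<in> P"
    by (rule in_class_nat[OF E0.subgroup_imp_group[OF normal_imp_subgroup[OF N0]]])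
  have Q: "group (E0 Mod N0)" by (rule normal.factorgroup_is_group[OF N0])
  have q: "(\<lambda>x. N0 #>\<^bsub>E0\<^esub> x) \<in> hom E0 (E0 Mod N0)" by (rule normal.r_coset_hom_Mod[OF N0])
  interpret q: group_hom E0 "E0 Mod N0" "\<lambda>x. N0 #>\<^bsub>E0\<^esub> x" by (rule group_homI[OF E0(1) Q q])
  have fgE0: "finitely_generated E0" by (rule \<theta>.finitely_generated_image[OF E(2) isoD(2)[OF \<theta>]])
  have q_surj: "(\<lambda>x. N0 #>\<^bsub>E0\<^esub> x) ` carrier E0 = carrier (E0 Mod N0)"
    by (simp add: carrier_FactGroup)
  have "finitely_generated (E0 Mod N0)" by (rule q.finitely_generated_image[OF fgE0 q_surj])
  then obtain H :: "nat monoid" where H: "group H" "E0 Mod N0 \<cong> H"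
    using finitely_generated_nat_copy[OF Q] by blast
  then obtain \<phi> where \<phi>: "\<phi> \<in> iso (E0 Mod N0) H" unfolding is_iso_def by blast
  define p where "p = \<phi> \<circ> (\<lambda>x. N0 #>\<^bsub>E0\<^esub> x)"
  have p: "p \<in> hom E0 H" unfolding p_def by (rule hom_compose[OF q isoD(1)[OF \<phi>]])
  have "p ` carrier E0 = carrier H"
    unfolding p_def image_comp[symmetric] q_surj by (rule isoD(2)[OF \<phi>])
  then have p_epi: "p \<in> epi E0 H" using p by (simp add: epi_def)
  have "finite (carrier (E0 Mod N0))" using N0_fin by (simp add: FactGroup_def)
  then have H_fin: "finite (carrier H)" using isoD(2)[OF \<phi>] by (metis finite_imageI)
  have "kernel E0 H p = kernel E0 (E0 Mod N0) (\<lambda>x. N0 #>\<^bsub>E0\<^esub> x)"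
    unfolding p_def by (rule iso_kernel_compose[OF Q H(1) q \<phi>])
  also have "\<dots> = N0"
    using E0.coset_join1[OF _ _ normal_imp_subgroup[OF N0]]
      E0.coset_join2[OF _ normal_imp_subgroup[OF N0]] E0.normal_subset[OF N0]
    by (auto simp: kernel_def)
  finally have ker: "kernel E0 H p = N0" .
  have incl: "id \<in> hom (E0\<lparr>carrier := N0\<rparr>) E0"
    using E0.normal_subset[OF N0] by (auto simp: hom_def)
  have "short_exact_sequence H E0 (E0\<lparr>carrier := N0\<rparr>) p id"
    unfolding short_exact_sequence_iff
    using ker incl p p_epi H(1) group_homI[OF mem_group[OF N0P] E0(1) incl] by (simp add: mon_def)
  then have "E0 \<in> P"
    using finite_ext N0P H_fin unfolding closed_under_finite_extensions_def by blast
  then show ?thesis using E0(2) unfolding in_class_def by blast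
qed

lemma in_class_power:
  assumes G: "group G" "in_class G P" and I: "finite I" "I \<noteq> {}"
  shows "in_class (product_group I (\<lambda>_ :: nat. G)) P"
proof -
  obtain H where H: "H \<in> P" "G \<cong> H" using G(2) unfolding in_class_def by blast
  have "product_group I (\<lambda>_. G) \<cong> product_group I (\<lambda>_. H)"
    by (rule iso_product_groupI[OF H(2) G(1) mem_group[OF H(1)]])
  moreover have "in_class (product_group I (\<lambda>_. H)) P"
    using products[unfolded closed_under_finite_products_def, rule_format, of I "\<lambda>_. H"] H(1) I by simp
  ultimately show ?thesis by (rule in_class_cong)
qed

end

section \<open>The class of the weak commutativity group\<close>

lemma (in group) normal_restrict:
  assumes N: "N \<lhd> G" and Y: "subgroup Y G" and sub: "N \<subseteq> Y"
  shows "N \<lhd> G\<lparr>carrier := Y\<rparr>"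
proof -
  interpret Y: group "G\<lparr>carrier := Y\<rparr>" by (rule subgroup_imp_group[OF Y])
  show ?thesis
  proof (rule Y.normal_invI)
    show "subgroup N (G\<lparr>carrier := Y\<rparr>)"
      by (rule subgroup_incl[OF normal_imp_subgroup[OF N] Y sub])
    fix x h assume "x \<in> carrier (G\<lparr>carrier := Y\<rparr>)" "h \<in> N"
    then show "x \<otimes>\<^bsub>G\<lparr>carrier := Y\<rparr>\<^esub> h \<otimes>\<^bsub>G\<lparr>carrier := Y\<rparr>\<^esub> inv\<^bsub>G\<lparr>carrier := Y\<rparr>\<^esub> x \<in> N"
      using conj_mem_normal[OF N, of x h] subgroup.mem_carrier[OF Y] Y by (simp add: m_inv_consistent)
  qed
qed

context weak_commutativity
begin

lemma finitely_generated_E: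
  assumes "finitely_generated G"
  shows "finitely_generated E"
proof -
  obtain S where S: "finite S" "S \<subseteq> carrier G" "generate G S = carrier G"
    using assms by (auto simp: finitely_generated_def)
  let ?T = "a ` S \<union> b ` S"
  have T: "?T \<subseteq> carrier E" using S(2) by auto
  have "a ` carrier G \<subseteq> generate E ?T" "b ` carrier G \<subseteq> generate E ?T"
    using a.generate_img[OF S(2)] b.generate_img[OF S(2)] S(3)
      E.mono_generate[of "a ` S" ?T] E.mono_generate[of "b ` S" ?T] by auto
  then have "generate E (a ` carrier G \<union> b ` carrier G) \<subseteq> generate E ?T"
    by (intro E.generate_subgroup_incl E.generate_is_subgroup T) simp
  then have "generate E ?T = carrier E"
    using E.generate_incl[OF T] carrier_generated by simp
  then show ?thesis
    unfolding finitely_generated_def using S(1) T by (intro exI[of _ ?T]) simp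
qed

lemma p\<^sub>3_surj: "p\<^sub>3 ` carrier E = carrier G"
proof
  show "carrier G \<subseteq> p\<^sub>3 ` carrier E"
  proof
    fix g assume "g \<in> carrier G"
    then show "g \<in> p\<^sub>3 ` carrier E" by (intro image_eqI[of _ _ "a g"]) auto
  qed
qed auto

text \<open>The map whose kernel \<open>W\<close> makes \<open>E / W\<close> a subgroup of the third
  power of \<open>G\<close>. The indices are natural numbers to fit the closure under products, and
  the restriction makes the values elements of the product group.\<close>

definition triple where
  "triple x = (\<lambda>i\<in>{0, 1, 2 :: nat}. if i = 0 then p\<^sub>1 x else if i = 1 then p\<^sub>2 x else p\<^sub>3 x)"

lemma triple_hom: "triple \<in> hom E (product_group {0, 1, 2} (\<lambda>_. G))"
  by (rule homI) (auto simp: triple_def)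

lemma kernel_triple: "kernel E (product_group {0, 1, 2} (\<lambda>_. G)) triple = W"
proof -
  have "triple x = (\<lambda>i\<in>{0, 1, 2}. \<one>\<^bsub>G\<^esub>) \<longleftrightarrow>
      p\<^sub>1 x = \<one>\<^bsub>G\<^esub> \<and> p\<^sub>2 x = \<one>\<^bsub>G\<^esub> \<and> p\<^sub>3 x = \<one>\<^bsub>G\<^esub>" for x
  proof
    assume "triple x = (\<lambda>i\<in>{0, 1, 2}. \<one>\<^bsub>G\<^esub>)"
    then have "triple x 0 = \<one>\<^bsub>G\<^esub>" "triple x 1 = \<one>\<^bsub>G\<^esub>" "triple x 2 = \<one>\<^bsub>G\<^esub>" by simp_all
    then show "p\<^sub>1 x = \<one>\<^bsub>G\<^esub> \<and> p\<^sub>2 x = \<one>\<^bsub>G\<^esub> \<and> p\<^sub>3 x = \<one>\<^bsub>G\<^esub>" by (simp add: triple_def)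
  qed (auto simp: triple_def)
  then show ?thesis by (auto simp: kernel_def W_def D_def L_def K\<^sub>1_def K\<^sub>2_def)
qed

end

context weak_commutativity_nilpotent
begin

lemma W_nilpotent:
  assumes "finitely_generated G"
  shows "\<exists>n. W \<subseteq> (centr Y ^^ n) {\<one>}"
proof -
  obtain S where S: "finite S" "S \<subseteq> carrier G" "generate G S = carrier G"
    using assms by (auto simp: finitely_generated_def)
  have Y: "Y \<subseteq> carrier E" by (auto simp: Y_def)
  have "W \<inter> carrier E \<subseteq> (centr Y ^^ Suc (card S)) L'"
    using L_nilpotent_mod_L'[OF S] E.funpow_centralizer_mod_mono[OF order_refl Y, of "Suc (card S)" L']
    unfolding W_def by blast
  moreover obtain n where "W \<inter> L' \<subseteq> (centr Y ^^ n) {\<one>}" using W_comms_L_L by blast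
  ultimately have "W \<inter> carrier E \<subseteq> (centr Y ^^ (Suc (card S) + n)) {\<one>}"
    by (rule E.funpow_centralizer_mod_compose[OF W_normal Y])
  then show ?thesis using E.normal_subset[OF W_normal] by blast
qed

end

section \<open>Ascent from \<open>Y / W\<close> to \<open>E\<close>\<close>

context
  fixes P :: "nat monoid set"
  assumes P: "fg_group_class P"
    and subgroups: "closed_under_fg_subgroups P"
    and quotients: "closed_under_quotients P"
    and central: "closed_under_central_extensions P"
    and finite_ext: "closed_under_finite_extensions P"
    and products: "closed_under_finite_products P"
begin

lemma in_class_weak_commutativity_nilpotent:
  assumes "weak_commutativity_nilpotent E G a b p\<^sub>1 p\<^sub>2 p\<^sub>3 K c"
    and G: "in_class G P" and K: "finite (rcosets\<^bsub>G\<^esub> K)"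
  shows "in_class E P"
proof -
  interpret weak_commutativity_nilpotent E G a b p\<^sub>1 p\<^sub>2 p\<^sub>3 K c by fact
  note facts = P subgroups quotients central finite_ext products
  have fgG: "finitely_generated G" by (rule in_class_fg[OF facts G.is_group G])
  have fgE: "finitely_generated E" by (rule finitely_generated_E[OF fgG])
  have Y: "subgroup Y E" by (rule normal_imp_subgroup[OF Y_normal])
  have Y_fin: "finite (rcosets\<^bsub>E\<^esub> Y)"
    unfolding Y_def by (rule p\<^sub>3.finite_rcosets_vimage(2)[OF normal_imp_subgroup[OF K_normal] K])
  let ?Y = "E\<lparr>carrier := Y\<rparr>"
  interpret Y: group ?Y by (rule E.subgroup_imp_group[OF Y])
  have fgY: "finitely_generated ?Y" by (rule E.finitely_generated_finite_index[OF fgE Y Y_fin])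
  have WY: "W \<subseteq> Y"
    using subgroup.one_closed[OF normal_imp_subgroup[OF K_normal]]
    by (auto simp: W_def L_def kernel_def Y_def)
  obtain n where n: "W \<subseteq> (centr Y ^^ n) {\<one>\<^bsub>E\<^esub>}" using W_nilpotent[OF fgG] by blast
  \<comment> \<open>A series from the trivial subgroup up to \<open>W\<close> whose successive
    factors are central in the corresponding quotients of \<open>Y\<close>.\<close>
  define N where "N i = W \<inter> (centr Y ^^ i) {\<one>\<^bsub>E\<^esub>}" for i
  have N: "N i \<lhd> E" for i
    unfolding N_def
    by (rule E.normal_subgroup_intersect[OF W_normal
          E.funpow_centralizer_mod_normal[OF Y_normal E.one_is_normal]])
  have NY: "N i \<lhd> ?Y" for i
    by (rule E.normal_restrict[OF N Y]) (use WY N_def in blast)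
  have step: "in_class (?Y Mod N i) P" if "in_class (?Y Mod N (Suc i)) P" for i
  proof (rule in_class_central_step[OF facts Y.is_group fgY NY NY _ _ that])
    have "(centr Y ^^ i) {\<one>\<^bsub>E\<^esub>} \<subseteq> centr Y ((centr Y ^^ i) {\<one>\<^bsub>E\<^esub>})"
      by (rule E.subset_centralizer_mod[OF E.funpow_centralizer_mod_normal[OF Y_normal E.one_is_normal]
            subgroup.subset[OF Y]])
    then show "N i \<subseteq> N (Suc i)" unfolding N_def by auto
    fix z y assume z: "z \<in> N (Suc i)" and "y \<in> carrier ?Y"
    then have y: "y \<in> Y" "y \<in> carrier E" using subgroup.mem_carrier[OF Y] by auto
    have zY: "z \<in> W" "z \<in> Y" "z \<in> centr Y ((centr Y ^^ i) {\<one>\<^bsub>E\<^esub>})"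
      using z WY by (auto simp: N_def)
    have "commutator ?Y z y = commutator E z y"
      using zY(2) y(1) by (simp add: commutator_def E.m_inv_consistent[OF Y])
    then show "commutator ?Y z y \<in> N i"
      using centralizer_modD[OF zY(3) y(1)] E.commutator_mem_normal_left[OF W_normal zY(1) y(2)]
      by (simp add: N_def)
  qed
  have "in_class (?Y Mod W) P"
  proof -
    have "triple \<in> hom ?Y (product_group {0, 1, 2} (\<lambda>_. G))"
      by (rule homI) (use hom_in_carrier[OF triple_hom] hom_mult[OF triple_hom]
          subgroup.mem_carrier[OF Y] in \<open>simp_all del: carrier_product_group mult_product_group\<close>)
    then have "in_class (?Y Mod kernel ?Y (product_group {0, 1, 2} (\<lambda>_. G)) triple) P"
      by (intro in_class_fg_image[OF facts] in_class_power[OF facts] Y.is_group fgY G G.is_group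
          product_group) auto
    moreover have "kernel ?Y (product_group {0, 1, 2} (\<lambda>_. G)) triple = W"
      using kernel_triple WY subgroup.mem_carrier[OF Y] unfolding kernel_def by auto
    ultimately show ?thesis by simp
  qed
  then have "in_class (?Y Mod N n) P" using n by (simp add: N_def Int_absorb2)
  then have "in_class (?Y Mod N 0) P" by (induction n) (use step in auto)
  \<comment> \<open>Writing the trivial subgroup as the kernel of the identity lets the first
    isomorphism theorem identify the last quotient with \<open>Y\<close> itself.\<close>
  moreover have "N 0 = kernel ?Y ?Y id"
    using subgroup.one_closed[OF normal_imp_subgroup[OF W_normal]] subgroup.one_closed[OF Y]
    by (auto simp: N_def kernel_def)
  moreover have "?Y \<cong> ?Y Mod kernel ?Y ?Y id"
  proof -
    interpret i: group_hom ?Y ?Y id by (rule group_homI[OF Y.is_group Y.is_group]) (simp add: hom_def)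
    have "?Y Mod kernel ?Y ?Y id \<cong> ?Y" by (rule i.FactGroup_iso) simp
    then show ?thesis by (rule group.iso_sym[OF normal.factorgroup_is_group[OF i.normal_kernel]])
  qed
  ultimately have "in_class ?Y P" using in_class_cong[OF facts] by simp
  then show ?thesis
    by (rule in_class_finite_extension[OF facts E.is_group fgE Y_normal Y_fin])
qed

lemma in_class_weak_commutativity:
  assumes "weak_commutativity E G a b p\<^sub>1 p\<^sub>2 p\<^sub>3" and G: "in_class G P"
    and metab: "\<forall>H\<in>P. metabelian H \<longrightarrow> virtually_nilpotent H"
  shows "in_class E P"
proof -
  interpret weak_commutativity E G a b p\<^sub>1 p\<^sub>2 p\<^sub>3 by fact
  note facts = P subgroups quotients central finite_ext products
  let ?N = "derived G (derived G (carrier G))"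
  have Q: "group (G Mod ?N)" by (rule normal.factorgroup_is_group[OF second_derived_normal])
  have q: "(\<lambda>x. ?N #>\<^bsub>G\<^esub> x) \<in> hom G (G Mod ?N)" by (rule normal.r_coset_hom_Mod[OF second_derived_normal])
  have q_surj: "(\<lambda>x. ?N #>\<^bsub>G\<^esub> x) ` carrier G = carrier (G Mod ?N)"
    by (simp add: carrier_FactGroup)
  have "in_class (G Mod ?N) P" by (rule in_class_surj[OF facts G.is_group G Q q q_surj])
  then obtain H \<theta> where H: "H \<in> P" "group H" "\<theta> \<in> iso (G Mod ?N) H"
    by (rule in_classE[OF facts])
  define f where "f = \<theta> \<circ> (\<lambda>x. ?N #>\<^bsub>G\<^esub> x)"
  interpret f: group_hom G H f
    unfolding f_def by (rule group_homI[OF G.is_group H(2) hom_compose[OF q isoD(1)[OF H(3)]]])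
  have f_surj: "f ` carrier G = carrier H"
    unfolding f_def image_comp[symmetric] q_surj by (rule isoD(2)[OF H(3)])
  have "kernel G H f = kernel G (G Mod ?N) (\<lambda>x. ?N #>\<^bsub>G\<^esub> x)"
    unfolding f_def by (rule iso_kernel_compose[OF Q H(2) q H(3)])
  also have "\<dots> = ?N"
    using G.coset_join1[OF _ _ normal_imp_subgroup[OF second_derived_normal]]
      G.coset_join2[OF _ normal_imp_subgroup[OF second_derived_normal]]
      G.normal_subset[OF second_derived_normal]
    by (auto simp: kernel_def)
  finally have ker: "kernel G H f = ?N" .
  \<comment> \<open>Surjective images preserve derived subgroups, and \<open>f\<close> has kernel
    \<open>G''\<close>; so \<open>H\<close>, a copy of \<open>G / G''\<close>, is
    metabelian.\<close>
  have "derived H (derived H (carrier H)) = f ` ?N"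
    unfolding f_surj[symmetric]
    using f.derived_img[of "carrier G"] f.derived_img[OF G.derived_in_carrier[of "carrier G"]] by simp
  also have "\<dots> = {\<one>\<^bsub>H\<^esub>}"
    using subgroup.one_closed[OF normal_imp_subgroup[OF second_derived_normal]] f.hom_one
    unfolding ker[symmetric] by (force simp: kernel_def)
  finally have "virtually_nilpotent H" using metab H(1) by (simp add: metabelian_def)
  then obtain K c where Kc: "K \<lhd> G" "finite (rcosets\<^bsub>G\<^esub> K)"
    "carrier G \<subseteq> (centralizer_mod G K ^^ c) ?N"
    using f.virtually_nilpotent_image[of ?N] ker unfolding kernel_def by blast
  then have "weak_commutativity_nilpotent E G a b p\<^sub>1 p\<^sub>2 p\<^sub>3 K c"
    by (intro weak_commutativity_nilpotent.intro weak_commutativity_nilpotent_axioms.intro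
        weak_commutativity_axioms)
  then show ?thesis by (rule in_class_weak_commutativity_nilpotent[OF _ G Kc(2)])
qed

end

theorem theoremK:
  fixes P :: "nat monoid set" and G :: "'a monoid"
  assumes "fg_group_class P"
    and "\<forall>H\<in>P. metabelian H \<longrightarrow> virtually_nilpotent H"
    and "closed_under_fg_subgroups P"
    and "closed_under_quotients P"
    and "closed_under_central_extensions P"
    and "closed_under_finite_extensions P"
    and "closed_under_finite_products P"
    and "group G"
  shows "in_class (\<XX> G) P \<longleftrightarrow> in_class G P"
proof -
  note facts = assms(1,3-7)
  obtain p\<^sub>1 p\<^sub>2 p\<^sub>3 where wc: "weak_commutativity (\<XX> G) G (left_copy G) (right_copy G) p\<^sub>1 p\<^sub>2 p\<^sub>3"
    using weak_commutativity_XX[OF assms(8)] by blast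
  then interpret weak_commutativity "\<XX> G" G "left_copy G" "right_copy G" p\<^sub>1 p\<^sub>2 p\<^sub>3 .
  \<comment> \<open>One direction is closure under quotients along \<open>p\<^sub>3\<close>, which
    maps \<open>\<XX> G\<close> onto \<open>G\<close>.\<close>
  show ?thesis
    using in_class_surj[OF facts E.is_group _ G.is_group p\<^sub>3_hom p\<^sub>3_surj]
      in_class_weak_commutativity[OF facts wc _ assms(2)] by blast
qed

end
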